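(* ($\mathsf{ZF}$, without the axiom of choice.) For all infinite cardinals $\mathfrak{a}$, \[ 2^{\mathrm{fin}(\mathrm{fin}(\mathfrak{a}))}=2^{\mathscr{B}_{\mathrm{fin}}(\mathfrak{a})}. \]
   Context: Work in $\mathsf{ZF}$ (Zermelo--Fraenkel set theory without the axiom of choice). Cardinals are cardinalities $|A|$ of arbitrary (not necessarily well-orderable) sets; $|A|=|B|$ means there is a bijection between $A$ and $B$; an infinite cardinal is the cardinality of an infinite (i.e. not finite) set. For $\mathfrak{a}=|A|$, $2^{\mathfrak{a}}=|\mathscr{P}(A)|$. $\mathrm{fin}(A)$ is the set of all finite subsets of $A$, and $\mathrm{fin}(\mathfrak{a})=|\mathrm{fin}(A)|$ where $|A|=\mathfrak{a}$. A partition of a set $A$ is a family of pairwise disjoint non-empty subsets of $A$ (called blocks) whose union is $A$; it is finitary if all its blocks are finite. $\mathscr{B}_{\mathrm{fin}}(A)$ is the set of all finitary partitions of $A$ with only finitely many non-singleton blocks, and $\mathscr{B}_{\mathrm{fin}}(\mathfrak{a})=|\mathscr{B}_{\mathrm{fin}}(A)|$ where $|A|=\mathfrak{a}$. *)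

theory Defs
  imports Main
begin

text \<open>
  HOL has the axiom of choice, so a claim about HOL sets would not be a claim of ZF without choice.
  We therefore interpret ZF in an arbitrary first-order structure: a type \<open>'v\<close> with a binary
  relation \<open>E\<close>, where \<open>E x y\<close> reads ``\<open>x\<close> is an element of \<open>y\<close>''. Separation and Replacement are the
  first-order schemas, ranging over formulas with parameters. (Ranging over all HOL predicates
  instead would make every structure satisfy the axiom of choice.) All set-theoretic notions below
  are internal to the structure: their quantifiers range over \<open>'v\<close> only. By completeness, a
  statement of this kind holds in all such structures iff it is a theorem of ZF.
\<close>

text \<open>Variables are de Bruijn indices; \<open>Forall\<close> binds index 0.\<close>

datatype fm = Member nat nat | Equal nat nat | Neg fm | Conj fm fm | Forall fm

primrec sat :: "('v \<Rightarrow> 'v \<Rightarrow> bool) \<Rightarrow> (nat \<Rightarrow> 'v) \<Rightarrow> fm \<Rightarrow> bool" where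
  "sat E e (Member i j) \<longleftrightarrow> E (e i) (e j)"
| "sat E e (Equal i j) \<longleftrightarrow> e i = e j"
| "sat E e (Neg p) \<longleftrightarrow> \<not> sat E e p"
| "sat E e (Conj p q) \<longleftrightarrow> sat E e p \<and> sat E e q"
| "sat E e (Forall p) \<longleftrightarrow> (\<forall>x. sat E (case_nat x e) p)"


locale ZF_model =
  fixes E :: "'v \<Rightarrow> 'v \<Rightarrow> bool"
  assumes extensionality: "(\<forall>z. E z x \<longleftrightarrow> E z y) \<Longrightarrow> x = y"
    and foundation: "\<exists>y. E y x \<Longrightarrow> \<exists>y. E y x \<and> \<not> (\<exists>z. E z x \<and> E z y)"
    and pairing: "\<exists>u. \<forall>z. E z u \<longleftrightarrow> z = x \<or> z = y"
    and union: "\<exists>u. \<forall>z. E z u \<longleftrightarrow> (\<exists>y. E z y \<and> E y x)"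
    and power_set: "\<exists>u. \<forall>z. E z u \<longleftrightarrow> (\<forall>w. E w z \<longrightarrow> E w x)"
    and infinity: "\<exists>I. (\<exists>z. E z I \<and> (\<forall>w. \<not> E w z)) \<and>
                     (\<forall>x. E x I \<longrightarrow> (\<exists>y. E y I \<and> (\<forall>w. E w y \<longleftrightarrow> E w x \<or> w = x)))"
    and separation: "\<exists>u. \<forall>z. E z u \<longleftrightarrow> E z x \<and> sat E (case_nat z e) p"
    and replacement:
      "(\<forall>y z z'. E y x \<and> sat E (case_nat y (case_nat z e)) p
                      \<and> sat E (case_nat y (case_nat z' e)) p \<longrightarrow> z = z') \<Longrightarrow>
       \<exists>u. \<forall>z. E z u \<longleftrightarrow> (\<exists>y. E y x \<and> sat E (case_nat y (case_nat z e)) p)"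


text \<open>
  \<open>coll E P\<close> is the element of the structure that represents the class of all \<open>x\<close> with \<open>P x\<close>;
  it is unspecified if there is none. The lemmas at the end show that in a model of ZF all uses of
  \<open>coll\<close> in the following definitions denote.
\<close>

definition coll :: "('v \<Rightarrow> 'v \<Rightarrow> bool) \<Rightarrow> ('v \<Rightarrow> bool) \<Rightarrow> 'v" where
  "coll E P = (THE s. \<forall>x. E x s \<longleftrightarrow> P x)"

definition sub_in :: "('v \<Rightarrow> 'v \<Rightarrow> bool) \<Rightarrow> 'v \<Rightarrow> 'v \<Rightarrow> bool" where
  "sub_in E x y \<longleftrightarrow> (\<forall>z. E z x \<longrightarrow> E z y)"

definition upair_in :: "('v \<Rightarrow> 'v \<Rightarrow> bool) \<Rightarrow> 'v \<Rightarrow> 'v \<Rightarrow> 'v" where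
  "upair_in E x y = coll E (\<lambda>z. z = x \<or> z = y)"

text \<open>Kuratowski pair.\<close>
definition pair_in :: "('v \<Rightarrow> 'v \<Rightarrow> bool) \<Rightarrow> 'v \<Rightarrow> 'v \<Rightarrow> 'v" where
  "pair_in E x y = upair_in E (upair_in E x x) (upair_in E x y)"

definition bij_in :: "('v \<Rightarrow> 'v \<Rightarrow> bool) \<Rightarrow> 'v \<Rightarrow> 'v \<Rightarrow> 'v \<Rightarrow> bool" where
  "bij_in E f A B \<longleftrightarrow>
     (\<forall>p. E p f \<longrightarrow> (\<exists>x y. E x A \<and> E y B \<and> p = pair_in E x y)) \<and>
     (\<forall>x. E x A \<longrightarrow> (\<exists>!y. E (pair_in E x y) f)) \<and>
     (\<forall>y. E y B \<longrightarrow> (\<exists>!x. E (pair_in E x y) f))"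

definition eqpoll_in :: "('v \<Rightarrow> 'v \<Rightarrow> bool) \<Rightarrow> 'v \<Rightarrow> 'v \<Rightarrow> bool" where
  "eqpoll_in E A B \<longleftrightarrow> (\<exists>f. bij_in E f A B)"

definition empty_in :: "('v \<Rightarrow> 'v \<Rightarrow> bool) \<Rightarrow> 'v" where
  "empty_in E = coll E (\<lambda>z. False)"

definition succ_in :: "('v \<Rightarrow> 'v \<Rightarrow> bool) \<Rightarrow> 'v \<Rightarrow> 'v" where
  "succ_in E x = coll E (\<lambda>z. E z x \<or> z = x)"

definition inductive_in :: "('v \<Rightarrow> 'v \<Rightarrow> bool) \<Rightarrow> 'v \<Rightarrow> bool" where
  "inductive_in E I \<longleftrightarrow> E (empty_in E) I \<and> (\<forall>x. E x I \<longrightarrow> E (succ_in E x) I)"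

text \<open>
  Natural numbers and finiteness are those of the structure; a set that is finite in this sense may
  have infinitely many elements when viewed from HOL.
\<close>

definition nat_in :: "('v \<Rightarrow> 'v \<Rightarrow> bool) \<Rightarrow> 'v \<Rightarrow> bool" where
  "nat_in E n \<longleftrightarrow> (\<forall>I. inductive_in E I \<longrightarrow> E n I)"

definition finite_in :: "('v \<Rightarrow> 'v \<Rightarrow> bool) \<Rightarrow> 'v \<Rightarrow> bool" where
  "finite_in E A \<longleftrightarrow> (\<exists>n. nat_in E n \<and> eqpoll_in E A n)"

definition Pow_in :: "('v \<Rightarrow> 'v \<Rightarrow> bool) \<Rightarrow> 'v \<Rightarrow> 'v" where
  "Pow_in E A = coll E (\<lambda>x. sub_in E x A)"

definition Fin_in :: "('v \<Rightarrow> 'v \<Rightarrow> bool) \<Rightarrow> 'v \<Rightarrow> 'v" where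
  "Fin_in E A = coll E (\<lambda>x. sub_in E x A \<and> finite_in E x)"

definition partition_in :: "('v \<Rightarrow> 'v \<Rightarrow> bool) \<Rightarrow> 'v \<Rightarrow> 'v \<Rightarrow> bool" where
  "partition_in E A P \<longleftrightarrow>
     (\<forall>b. E b P \<longrightarrow> (\<exists>x. E x b) \<and> sub_in E b A) \<and>
     (\<forall>b c. E b P \<and> E c P \<and> b \<noteq> c \<longrightarrow> \<not> (\<exists>x. E x b \<and> E x c)) \<and>
     (\<forall>x. E x A \<longrightarrow> (\<exists>b. E b P \<and> E x b))"

definition singleton_in :: "('v \<Rightarrow> 'v \<Rightarrow> bool) \<Rightarrow> 'v \<Rightarrow> bool" where
  "singleton_in E b \<longleftrightarrow> (\<exists>x. \<forall>z. E z b \<longleftrightarrow> z = x)"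

definition nonsingletons_in :: "('v \<Rightarrow> 'v \<Rightarrow> bool) \<Rightarrow> 'v \<Rightarrow> 'v" where
  "nonsingletons_in E P = coll E (\<lambda>b. E b P \<and> \<not> singleton_in E b)"

definition Bfin_in :: "('v \<Rightarrow> 'v \<Rightarrow> bool) \<Rightarrow> 'v \<Rightarrow> 'v" where
  "Bfin_in E A = coll E (\<lambda>P. partition_in E A P \<and> (\<forall>b. E b P \<longrightarrow> finite_in E b) \<and>
                             finite_in E (nonsingletons_in E P))"


definition definable :: "('v \<Rightarrow> 'v \<Rightarrow> bool) \<Rightarrow> ((nat \<Rightarrow> 'v) \<Rightarrow> bool) \<Rightarrow> bool" where
  "definable E P \<longleftrightarrow> (\<exists>p. \<forall>e. P e \<longleftrightarrow> sat E e p)"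

lemma definable_mem: "definable E (\<lambda>e. E (e i) (e j))"
  unfolding definable_def by (rule exI[of _ "Member i j"]) simp

lemma definable_eq: "definable E (\<lambda>e. e i = e j)"
  unfolding definable_def by (rule exI[of _ "Equal i j"]) simp

lemma definable_not: "definable E P \<Longrightarrow> definable E (\<lambda>e. \<not> P e)"
  unfolding definable_def by (metis sat.simps(3))

lemma definable_conj: "definable E P \<Longrightarrow> definable E Q \<Longrightarrow> definable E (\<lambda>e. P e \<and> Q e)"
  unfolding definable_def by (metis sat.simps(4))

lemma definable_disj:
  assumes "definable E P" "definable E Q" shows "definable E (\<lambda>e. P e \<or> Q e)"
  using definable_not[OF definable_conj[OF definable_not[OF assms(1)] definable_not[OF assms(2)]]]
  by simp

lemma definable_imp:
  assumes "definable E P" "definable E Q" shows "definable E (\<lambda>e. P e \<longrightarrow> Q e)"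
  using definable_not[OF definable_conj[OF assms(1) definable_not[OF assms(2)]]] by simp

lemma definable_iff:
  assumes "definable E P" "definable E Q" shows "definable E (\<lambda>e. P e \<longleftrightarrow> Q e)"
  using definable_conj[OF definable_imp[OF assms] definable_imp[OF assms(2,1)]]
  by (simp add: iff_conv_conj_imp)

lemma definable_all:
  assumes "definable E (\<lambda>e. Q (\<lambda>n. e (Suc n)) (e 0))" shows "definable E (\<lambda>e. \<forall>x. Q e x)"
proof -
  obtain p where "Q (\<lambda>n. e (Suc n)) (e 0) \<longleftrightarrow> sat E e p" for e
    using assms unfolding definable_def by blast
  from this[of "case_nat _ _"] have "(\<forall>x. Q e x) \<longleftrightarrow> sat E e (Forall p)" for e by simp
  then show ?thesis unfolding definable_def by blast
qed

lemma definable_ex: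
  assumes "definable E (\<lambda>e. Q (\<lambda>n. e (Suc n)) (e 0))" shows "definable E (\<lambda>e. \<exists>x. Q e x)"
  using definable_not[OF definable_all[of E "\<lambda>e x. \<not> Q e x", OF definable_not[OF assms]]] by simp

lemmas definable_intros = definable_mem definable_eq definable_not definable_conj definable_disj
  definable_imp definable_iff definable_all definable_ex


context ZF_model
begin

lemma mem_coll:
  assumes "\<exists>s. \<forall>x. E x s \<longleftrightarrow> P x" shows "E x (coll E P) \<longleftrightarrow> P x"
proof -
  from assms obtain s where s: "\<forall>x. E x s \<longleftrightarrow> P x" by blast
  have "coll E P = s"
    unfolding coll_def by (rule the_equality) (use s extensionality in blast)+
  with s show ?thesis by simp
qed

lemma ext_iff: "x = y \<longleftrightarrow> (\<forall>z. E z x \<longleftrightarrow> E z y)"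
  using extensionality by blast

lemma definable_separation:
  assumes "definable E P" shows "\<exists>u. \<forall>z. E z u \<longleftrightarrow> E z x \<and> P (case_nat z e)"
proof -
  obtain p where "\<forall>e. P e \<longleftrightarrow> sat E e p" using assms unfolding definable_def by blast
  then show ?thesis using separation[of x e p] by simp
qed

lemma mem_upair [simp]: "E z (upair_in E x y) \<longleftrightarrow> z = x \<or> z = y"
  unfolding upair_in_def by (rule mem_coll[OF pairing])

lemma mem_empty [simp]: "\<not> E z (empty_in E)"
proof -
  have "\<exists>s. \<forall>x. E x s \<longleftrightarrow> False" using infinity by blast
  from mem_coll[OF this] show ?thesis unfolding empty_in_def by blast
qed

lemma mem_succ [simp]: "E z (succ_in E x) \<longleftrightarrow> E z x \<or> z = x"
proof -
  obtain u where "\<forall>z. E z u \<longleftrightarrow> (\<exists>y. E z y \<and> E y (upair_in E x (upair_in E x x)))"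
    using union by blast
  then have "\<forall>z. E z u \<longleftrightarrow> E z x \<or> z = x" unfolding mem_upair by (metis mem_upair)
  then have "\<exists>s. \<forall>z. E z s \<longleftrightarrow> E z x \<or> z = x" ..
  from mem_coll[OF this] show ?thesis unfolding succ_in_def .
qed

lemma mem_Pow [simp]: "E z (Pow_in E A) \<longleftrightarrow> sub_in E z A"
  unfolding Pow_in_def by (rule mem_coll) (use power_set in \<open>simp add: sub_in_def\<close>)

lemma pair_eq_iff [simp]: "pair_in E x y = pair_in E x' y' \<longleftrightarrow> x = x' \<and> y = y'"
proof
  assume eq: "pair_in E x y = pair_in E x' y'"
  have up: "upair_in E a b = upair_in E c d \<longleftrightarrow> a = c \<and> b = d \<or> a = d \<and> b = c"
    for a b c d
  proof
    assume "upair_in E a b = upair_in E c d"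
    then have "z = a \<or> z = b \<longleftrightarrow> z = c \<or> z = d" for z
      using mem_upair[of z a b] mem_upair[of z c d] by simp
    then show "a = c \<and> b = d \<or> a = d \<and> b = c" by metis
  qed (auto intro!: extensionality)
  from eq show "x = x' \<and> y = y'" unfolding pair_in_def up by auto
qed simp

lemma nonempty_inductive: "\<exists>I. inductive_in E I"
proof -
  obtain I z where I: "E z I" "\<forall>w. \<not> E w z"
    "\<forall>x. E x I \<longrightarrow> (\<exists>y. E y I \<and> (\<forall>w. E w y \<longleftrightarrow> E w x \<or> w = x))"
    using infinity by blast
  have "z = empty_in E" by (rule extensionality) (use I(2) in simp)
  moreover have "E (succ_in E x) I" if x: "E x I" for x
  proof -
    obtain y where "E y I" "\<forall>w. E w y \<longleftrightarrow> E w x \<or> w = x" using I(3) x by blast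
    then have "y = succ_in E x" by (intro extensionality) simp
    with \<open>E y I\<close> show ?thesis by simp
  qed
  ultimately show ?thesis using I(1) unfolding inductive_in_def by blast
qed

lemma definable_mem_pair: "definable E (\<lambda>e. E (pair_in E (e i) (e j)) (e k))"
proof -
  have "E (pair_in E x y) f \<longleftrightarrow>
      (\<exists>p. E p f \<and> (\<forall>u. E u p \<longleftrightarrow> (\<forall>z. E z u \<longleftrightarrow> z = x) \<or> (\<forall>z. E z u \<longleftrightarrow> z = x \<or> z = y)))"
    for x y f
  proof -
    have up: "u = upair_in E a b \<longleftrightarrow> (\<forall>z. E z u \<longleftrightarrow> z = a \<or> z = b)" for u a b
      by (simp add: ext_iff[of u "upair_in E a b"])
    have "(\<forall>u. E u p \<longleftrightarrow> (\<forall>z. E z u \<longleftrightarrow> z = x) \<or> (\<forall>z. E z u \<longleftrightarrow> z = x \<or> z = y)) \<longleftrightarrow>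
          p = pair_in E x y" for p
      unfolding pair_in_def up[of p] up by simp
    then show ?thesis by simp
  qed
  then show ?thesis by (simp only:) (intro definable_intros)
qed

lemma definable_eq_pair: "definable E (\<lambda>e. e k = pair_in E (e i) (e j))"
proof -
  have "p = pair_in E x y \<longleftrightarrow> (\<forall>s. (\<forall>z. E z s \<longleftrightarrow> z = p) \<longrightarrow> E (pair_in E x y) s)" for p x y
  proof -
    have "(\<forall>z. E z s \<longleftrightarrow> z = p) \<longleftrightarrow> s = upair_in E p p" for s
      by (simp add: ext_iff[of s "upair_in E p p"])
    then show ?thesis by (auto simp del: pair_eq_iff)
  qed
  then show ?thesis by (simp only:) (intro definable_intros definable_mem_pair)
qed

lemma definable_bij: "definable E (\<lambda>e. bij_in E (e i) (e j) (e k))"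
  unfolding bij_in_def Ex1_def
  by (intro definable_intros definable_mem_pair definable_eq_pair)

lemma definable_eqpoll: "definable E (\<lambda>e. eqpoll_in E (e i) (e j))"
  unfolding eqpoll_in_def by (intro definable_intros definable_bij)

lemma definable_inductive: "definable E (\<lambda>e. inductive_in E (e i))"
proof -
  have "inductive_in E I \<longleftrightarrow> (\<exists>z. E z I \<and> (\<forall>w. \<not> E w z)) \<and>
      (\<forall>x. E x I \<longrightarrow> (\<exists>y. E y I \<and> (\<forall>w. E w y \<longleftrightarrow> E w x \<or> w = x)))" for I
  proof -
    have z: "(\<forall>w. \<not> E w z) \<longleftrightarrow> z = empty_in E" for z
      by (simp add: ext_iff[of z "empty_in E"])
    have y: "(\<forall>w. E w y \<longleftrightarrow> E w x \<or> w = x) \<longleftrightarrow> y = succ_in E x" for x y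
      by (simp add: ext_iff[of y "succ_in E x"])
    show ?thesis unfolding inductive_in_def z y by blast
  qed
  then show ?thesis by (simp only:) (intro definable_intros)
qed

lemma definable_finite: "definable E (\<lambda>e. finite_in E (e i))"
  unfolding finite_in_def nat_in_def
  by (intro definable_intros definable_inductive definable_eqpoll)

lemma mem_Fin [simp]: "E x (Fin_in E A) \<longleftrightarrow> sub_in E x A \<and> finite_in E x"
  unfolding Fin_in_def
  by (rule mem_coll) (use definable_separation[OF definable_finite[of 0], of "Pow_in E A"] in simp)

lemma definable_singleton: "definable E (\<lambda>e. singleton_in E (e i))"
  unfolding singleton_in_def by (intro definable_intros)

lemma mem_nonsingletons [simp]:
  "E b (nonsingletons_in E P) \<longleftrightarrow> E b P \<and> \<not> singleton_in E b"
  unfolding nonsingletons_in_def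
  by (rule mem_coll)
    (use definable_separation[OF definable_not[OF definable_singleton[of 0]], of P] in simp)

lemma mem_Bfin [simp]:
  "E P (Bfin_in E A) \<longleftrightarrow> partition_in E A P \<and> (\<forall>b. E b P \<longrightarrow> finite_in E b) \<and>
                          finite_in E (nonsingletons_in E P)"
proof -
  let ?Q = "\<lambda>A P. partition_in E A P \<and> (\<forall>b. E b P \<longrightarrow> finite_in E b) \<and>
                   finite_in E (nonsingletons_in E P)"
  have "finite_in E (nonsingletons_in E P) \<longleftrightarrow>
      (\<exists>s. (\<forall>b. E b s \<longleftrightarrow> E b P \<and> \<not> singleton_in E b) \<and> finite_in E s)" for P
  proof -
    have "(\<forall>b. E b s \<longleftrightarrow> E b P \<and> \<not> singleton_in E b) \<longleftrightarrow> s = nonsingletons_in E P" for s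
      by (simp add: ext_iff[of s "nonsingletons_in E P"])
    then show ?thesis by simp
  qed
  then have "definable E (\<lambda>e. ?Q (e 1) (e 0))"
    unfolding partition_in_def sub_in_def
    by (simp only:) (intro definable_intros definable_finite definable_singleton)
  from definable_separation[OF this, of "Pow_in E (Pow_in E A)" "\<lambda>_. A"]
  have "\<exists>s. \<forall>P. E P s \<longleftrightarrow> sub_in E P (Pow_in E A) \<and> ?Q A P" by simp
  then obtain s where s: "\<forall>P. E P s \<longleftrightarrow> sub_in E P (Pow_in E A) \<and> ?Q A P" ..
  have "sub_in E P (Pow_in E A)" if "partition_in E A P" for P
    unfolding sub_in_def[of E P] mem_Pow using that[unfolded partition_in_def, THEN conjunct1]
    by blast
  then have "E P s \<longleftrightarrow> ?Q A P" for P unfolding s[rule_format] by blast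
  then have "\<exists>s. \<forall>P. E P s \<longleftrightarrow> ?Q A P" by (intro exI[of _ s] allI)
  from mem_coll[OF this] show ?thesis unfolding Bfin_in_def .
qed

end

end

theory Submission imports Defs begin

text \<open>
  Two injections are given, and the Schroeder-Bernstein theorem joins them. A partition in
  \<open>B_fin(A)\<close> is determined by the finite set of its non-singleton blocks, so \<open>B_fin(A)\<close> embeds in
  \<open>fin(fin(A))\<close>, and taking images embeds the power set of the former in the power set of the
  latter.

  The converse is the substance. In general \<open>B_fin(A)\<close> need not map onto \<open>fin(fin(A))\<close>: a partition
  cannot single out an element of one of its blocks. A partition can, however, carry a blurred
  version of a finite family \<open>F'\<close> of finite sets, in which each point \<open>d\<close> of the union of \<open>F'\<close> is
  replaced by a block, the fibre of \<open>d\<close>, and each member \<open>S\<close> of \<open>F'\<close> is recorded by two blocks of equal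
  size, the tags of \<open>S\<close>, which have two elements more than the union of the fibres over \<open>S\<close>. If the
  fibres grow fast enough, then different subsets of the union of \<open>F'\<close> have fibres of different
  total size and no tag is as large as a fibre. So the partition shows which blocks are fibres (the
  non-singletons whose size occurs once) and which sets of fibres are tagged. The families \<open>F\<close> that
  the partition decodes to are the copies of \<open>F'\<close> obtained by choosing one point in each fibre;
  see \<open>decodes\<close>, \<open>decodes_iff_copy\<close> and \<open>partition_of_admissible\<close>.

  A subset \<open>X\<close> of \<open>fin(fin(A))\<close> is coded by the set of the partitions that decode to an odd number of
  elements of \<open>X\<close>. Suppose that \<open>X\<close> and \<open>X'\<close> have the same code, and let \<open>Y\<close> be their symmetric difference.
  Counting modulo 2 is additive, so every partition decodes to an even number of elements of \<open>Y\<close>.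
  If all points of an element \<open>F'\<close> of \<open>Y\<close> are blurred, the number of copies in \<open>Y\<close> is thus even. The key
  lemma \<open>even_copies_step\<close> shows that it stays even when one fibre is shrunk back to a single
  point. After finitely many steps nothing is blurred, the only copy of \<open>F'\<close> is \<open>F'\<close> itself, and the
  even number is 1: contradiction. This is \<open>odd_code_inj\<close>.

  Everything happens inside the structure. Finiteness and parity are internal, hence
  each argument by finite induction and each formation of a set needs a first-order formula.
\<close>

section \<open>Definability with parameters\<close>

text \<open>
  Separation, Replacement and every internal induction apply to first-order formulas only, so the
  predicates used below have to be recognised as definable. This part sets up closure properties
  that reduce such a claim to a syntax-directed search.

  Combining two formulas makes one list of parameters out of two, which moves the free variables of
  both; hence the closure under renaming of variables.
\<close>

lemma sat_rename: "\<exists>q. \<forall>e. sat E e q \<longleftrightarrow> sat E (\<lambda>n. e (r n)) p"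
proof (induction p arbitrary: r)
  case (Member i j) show ?case by (rule exI[of _ "Member (r i) (r j)"]) simp
next
  case (Equal i j) show ?case by (rule exI[of _ "Equal (r i) (r j)"]) simp
next
  case (Neg p) then obtain q where "\<forall>e. sat E e q \<longleftrightarrow> sat E (\<lambda>n. e (r n)) p" by blast
  then show ?case by (intro exI[of _ "Neg q"]) simp
next
  case (Conj p p')
  obtain q where "\<forall>e. sat E e q \<longleftrightarrow> sat E (\<lambda>n. e (r n)) p" using Conj(1) by blast
  moreover obtain q' where "\<forall>e. sat E e q' \<longleftrightarrow> sat E (\<lambda>n. e (r n)) p'" using Conj(2) by blast
  ultimately show ?case by (intro exI[of _ "Conj q q'"]) simp
next
  case (Forall p)
  define r' where "r' = case_nat 0 (\<lambda>n. Suc (r n))"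
  obtain q where q: "\<forall>e. sat E e q \<longleftrightarrow> sat E (\<lambda>n. e (r' n)) p" using Forall by blast
  have r': "(\<lambda>n. case_nat x e (r' n)) = case_nat x (\<lambda>n. e (r n))" for x and e :: "nat \<Rightarrow> 'a"
    by (rule ext) (simp add: r'_def split: nat.split)
  show ?case by (rule exI[of _ "Forall q"]) (simp only: sat.simps q r' simp_thms)
qed

lemma definable_rename:
  assumes "definable E P" shows "definable E (\<lambda>e. P (\<lambda>n. e (r n)))"
proof -
  obtain p where p: "\<forall>e. P e \<longleftrightarrow> sat E e p" using assms unfolding definable_def by blast
  obtain q where "\<forall>e. sat E e q \<longleftrightarrow> sat E (\<lambda>n. e (r n)) p" using sat_rename by blast
  with p show ?thesis unfolding definable_def by (intro exI[of _ q]) simp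
qed

text \<open>
  An environment that holds parameters \<open>c\<close> at the even positions and the variables \<open>e\<close> at the odd
  ones. With infinitely many places for each, no bookkeeping of lengths is necessary.
\<close>

definition mix :: "(nat \<Rightarrow> 'v) \<Rightarrow> (nat \<Rightarrow> 'v) \<Rightarrow> nat \<Rightarrow> 'v" where
  "mix c e n = (if even n then c (n div 2) else e (n div 2))"

lemma mix_even [simp]: "mix c e (2 * k) = c k"
  and mix_odd [simp]: "mix c e (Suc (2 * k)) = e k"
  by (simp_all add: mix_def)

lemma even_odd_nat: obtains k :: nat where "n = 2 * k" | k where "n = Suc (2 * k)"
  by (metis evenE oddE Suc_eq_plus1)

named_theorems dfn

context ZF_model
begin

text \<open>
  Definability from parameters. As in \<open>definable_all\<close>, a quantifier binds position 0 and moves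
  the other variables up by one. A definable term is one with a definable graph. The rules in
  \<open>dfn\<close> follow the syntax of predicates and terms; in them a fixed element of the structure is
  a constant term and so becomes a parameter.
\<close>

definition pdef :: "((nat \<Rightarrow> 'v) \<Rightarrow> bool) \<Rightarrow> bool" where
  "pdef P \<longleftrightarrow> (\<exists>Q c. definable E Q \<and> (\<forall>e. P e \<longleftrightarrow> Q (mix c e)))"

definition dterm :: "((nat \<Rightarrow> 'v) \<Rightarrow> 'v) \<Rightarrow> bool" where
  "dterm t \<longleftrightarrow> pdef (\<lambda>e. e 0 = t (\<lambda>n. e (Suc n)))"

lemma pdef_rename:
  assumes "pdef P" shows "pdef (\<lambda>e. P (\<lambda>n. e (r n)))"
proof -
  obtain Q c where Q: "definable E Q" "\<And>e. P e \<longleftrightarrow> Q (mix c e)"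
    using assms unfolding pdef_def by blast
  define s where "s n = (if even n then n else Suc (2 * r (n div 2)))" for n
  have "mix c (\<lambda>n. e (r n)) = (\<lambda>n. mix c e (s n))" for e
    by (rule ext) (simp add: mix_def s_def)
  then show ?thesis unfolding pdef_def Q(2)
    using definable_rename[OF Q(1), of s] by (intro exI[of _ "\<lambda>e. Q (\<lambda>n. e (s n))"] exI[of _ c]) simp
qed

lemma pdef_definable:
  assumes "definable E P" shows "pdef P"
proof -
  have "(\<lambda>n. mix c e (Suc (2 * n))) = e" for e c :: "nat \<Rightarrow> 'v" by (simp add: mix_def)
  then show ?thesis unfolding pdef_def
    using definable_rename[OF assms, of "\<lambda>n. Suc (2 * n)"]
    by (intro exI[of _ "\<lambda>e. P (\<lambda>n. e (Suc (2 * n)))"]) simp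
qed

lemma pdef_not [dfn]:
  assumes "pdef P" shows "pdef (\<lambda>e. \<not> P e)"
proof -
  obtain Q c where Q: "definable E Q" "\<And>e. P e \<longleftrightarrow> Q (mix c e)"
    using assms unfolding pdef_def by blast
  show ?thesis unfolding pdef_def Q(2)
    by (intro exI[of _ "\<lambda>e. \<not> Q e"] exI[of _ c] conjI definable_not Q(1)) simp
qed

text \<open>
  The two parameter sequences are merged by \<open>mix\<close> itself, and each formula reads its own
  half through a renaming.
\<close>

lemma pdef_conj [dfn]:
  assumes "pdef P" "pdef P'" shows "pdef (\<lambda>e. P e \<and> P' e)"
proof -
  obtain Q c where Q: "definable E Q" "\<And>e. P e \<longleftrightarrow> Q (mix c e)"
    using assms(1) unfolding pdef_def by blast
  obtain Q' c' where Q': "definable E Q'" "\<And>e. P' e \<longleftrightarrow> Q' (mix c' e)"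
    using assms(2) unfolding pdef_def by blast
  define r where "r n = (if even n then 2 * n else n)" for n :: nat
  define r' where "r' n = (if even n then 2 * Suc n else n)" for n :: nat
  have 1: "(\<lambda>n. mix (mix c c') e (r n)) = mix c e" for e
  proof
    fix n show "mix (mix c c') e (r n) = mix c e n"
    proof (cases n rule: even_odd_nat)
      case (1 k) then have "r n = 2 * (2 * k)" by (simp add: r_def)
      with 1 show ?thesis by (simp only: mix_even)
    next
      case (2 k) then have "r n = Suc (2 * k)" by (simp add: r_def)
      with 2 show ?thesis by (simp only: mix_odd)
    qed
  qed
  have 2: "(\<lambda>n. mix (mix c c') e (r' n)) = mix c' e" for e
  proof
    fix n show "mix (mix c c') e (r' n) = mix c' e n"
    proof (cases n rule: even_odd_nat)
      case (1 k) then have "r' n = 2 * Suc (2 * k)" by (simp add: r'_def)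
      with 1 show ?thesis by (simp only: mix_even mix_odd)
    next
      case (2 k) then have "r' n = Suc (2 * k)" by (simp add: r'_def)
      with 2 show ?thesis by (simp only: mix_odd)
    qed
  qed
  have "definable E (\<lambda>e. Q (\<lambda>n. e (r n)) \<and> Q' (\<lambda>n. e (r' n)))"
    by (rule definable_conj[OF definable_rename[OF Q(1)] definable_rename[OF Q'(1)]])
  then show ?thesis unfolding pdef_def
    by (intro exI[of _ "\<lambda>e. Q (\<lambda>n. e (r n)) \<and> Q' (\<lambda>n. e (r' n))"] exI[of _ "mix c c'"] conjI)
      (simp_all only: 1 2 Q(2) Q'(2) simp_thms)
qed

lemma pdef_all [dfn]:
  assumes "pdef (\<lambda>e. P (\<lambda>n. e (Suc n)) (e 0))" shows "pdef (\<lambda>e. \<forall>x. P e x)"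
proof -
  obtain Q c where Q: "definable E Q" "\<And>e. P (\<lambda>n. e (Suc n)) (e 0) \<longleftrightarrow> Q (mix c e)"
    using assms unfolding pdef_def by blast
  \<comment> \<open>Among the mixed positions the newly bound variable is 1; parameters keep their even positions
     and the remaining variables come two places later than before the binding.\<close>
  define r where "r n = (if even n then Suc n else n - 1)" for n :: nat
  have r: "mix c (case_nat x e) = (\<lambda>n. case_nat x (mix c e) (r n))" for x e
  proof
    fix n show "mix c (case_nat x e) n = case_nat x (mix c e) (r n)"
    proof (cases "even n")
      case True then show ?thesis by (simp add: mix_def r_def)
    next
      case False then obtain k where "n = Suc (2 * k)" by (metis oddE Suc_eq_plus1)
      then show ?thesis by (cases k) (simp_all add: mix_def r_def)
    qed
  qed
  have P: "P e x \<longleftrightarrow> Q (\<lambda>n. case_nat x (mix c e) (r n))" for e x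
    using Q(2)[of "case_nat x e"] by (simp add: r)
  have "definable E (\<lambda>e. \<forall>x. Q (\<lambda>n. case_nat x e (r n)))"
  proof (rule definable_all)
    have "(case_nat (e 0) (\<lambda>n. e (Suc n)) :: nat \<Rightarrow> 'v) = e" for e
      by (rule ext) (simp split: nat.split)
    then show "definable E (\<lambda>e. Q (\<lambda>n. case_nat (e 0) (\<lambda>n. e (Suc n)) (r n)))"
      using definable_rename[OF Q(1), of r] by simp
  qed
  then show ?thesis unfolding pdef_def
    by (intro exI[of _ "\<lambda>e. \<forall>x. Q (\<lambda>n. case_nat x e (r n))"] exI[of _ c] conjI)
      (use P in auto)
qed

lemma pdef_disj [dfn]: "pdef P \<Longrightarrow> pdef Q \<Longrightarrow> pdef (\<lambda>e. P e \<or> Q e)"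
  using pdef_not[OF pdef_conj[OF pdef_not pdef_not, of P Q]] by simp

lemma pdef_imp [dfn]: "pdef P \<Longrightarrow> pdef Q \<Longrightarrow> pdef (\<lambda>e. P e \<longrightarrow> Q e)"
  using pdef_not[OF pdef_conj[OF _ pdef_not, of P Q]] by simp

lemma pdef_iff [dfn]: "pdef P \<Longrightarrow> pdef Q \<Longrightarrow> pdef (\<lambda>e. P e \<longleftrightarrow> Q e)"
  using pdef_conj[OF pdef_imp pdef_imp, of P Q Q P] by (simp add: iff_conv_conj_imp)

lemma pdef_ex [dfn]:
  "pdef (\<lambda>e. P (\<lambda>n. e (Suc n)) (e 0)) \<Longrightarrow> pdef (\<lambda>e. \<exists>x. P e x)"
  using pdef_not[OF pdef_all[OF pdef_not, of P]] by simp

lemma dterm_var [dfn]: "dterm (\<lambda>e. e i)"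
  unfolding dterm_def by (intro pdef_definable definable_eq)

lemma dterm_const [dfn]: "dterm (\<lambda>e. c)"
proof -
  have "e 0 = c \<longleftrightarrow> mix (\<lambda>_. c) e 1 = mix (\<lambda>_. c) e 0" for e by (simp add: mix_def)
  then show ?thesis unfolding dterm_def pdef_def
    by (intro exI[of _ "\<lambda>e. e 1 = e 0"] exI[of _ "\<lambda>_. c"] conjI definable_eq) simp
qed

text \<open>A term is substituted by way of \<open>Q e (t e) \<longleftrightarrow> (\<exists>x. x = t e \<and> Q e x)\<close>.\<close>

lemma pdef_subst:
  assumes "pdef (\<lambda>e. Q (\<lambda>n. e (Suc n)) (e 0))" "dterm t" shows "pdef (\<lambda>e. Q e (t e))"
proof -
  have "pdef (\<lambda>e. \<exists>x. x = t e \<and> Q e x)"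
    by (intro pdef_ex pdef_conj assms assms(2)[unfolded dterm_def])
  then show ?thesis by simp
qed

lemma dterm_shift: "dterm t \<Longrightarrow> dterm (\<lambda>e. t (\<lambda>n. e (Suc n)))"
  unfolding dterm_def
  using pdef_rename[of "\<lambda>e. e 0 = t (\<lambda>n. e (Suc n))" "case_nat 0 (\<lambda>n. Suc (Suc n))"] by simp

lemma pdef_shift1:
  "pdef (\<lambda>e. Q (\<lambda>n. e (Suc n)) (e 0)) \<Longrightarrow> pdef (\<lambda>e. Q (\<lambda>n. e (Suc (Suc n))) (e 0))"
  using pdef_rename[of "\<lambda>e. Q (\<lambda>n. e (Suc n)) (e 0)" "case_nat 0 (\<lambda>n. Suc (Suc n))"] by simp

text \<open>
  These rules lift a definability claim about distinct variables to arbitrary definable terms, so that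
  each new notion needs its definition unfolded only once.
\<close>

lemma pdef_app1:
  assumes "pdef (\<lambda>e. R (e 0))" "dterm s" shows "pdef (\<lambda>e. R (s e))"
  by (rule pdef_subst[where Q = "\<lambda>e. R", OF assms])

lemma pdef_app2:
  assumes R: "pdef (\<lambda>e. R (e 0) (e (Suc 0)))" and s: "dterm s" and t: "dterm t"
  shows "pdef (\<lambda>e. R (s e) (t e))"
proof (rule pdef_subst[where Q = "\<lambda>e. R (s e)", OF _ t])
  show "pdef (\<lambda>e. R (s (\<lambda>n. e (Suc n))) (e 0))"
    by (rule pdef_subst[where Q = "\<lambda>e x. R x (e 0)", OF R dterm_shift[OF s]])
qed

lemma pdef_app3:
  assumes R: "pdef (\<lambda>e. R (e 0) (e (Suc 0)) (e (Suc (Suc 0))))"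
    and s: "dterm s" and t: "dterm t" and u: "dterm u"
  shows "pdef (\<lambda>e. R (s e) (t e) (u e))"
proof (rule pdef_subst[where Q = "\<lambda>e. R (s e) (t e)", OF _ u])
  show "pdef (\<lambda>e. R (s (\<lambda>n. e (Suc n))) (t (\<lambda>n. e (Suc n))) (e 0))"
  proof (rule pdef_subst[where Q = "\<lambda>e x. R (s (\<lambda>n. e (Suc n))) x (e 0)", OF _ dterm_shift[OF t]])
    show "pdef (\<lambda>e. R (s (\<lambda>n. e (Suc (Suc n)))) (e 0) (e (Suc 0)))"
      by (rule pdef_subst[where Q = "\<lambda>e x. R x (e 0) (e (Suc 0))", OF R
            dterm_shift[OF dterm_shift[OF s]]])
  qed
qed

lemma dterm_app1:
  assumes f: "dterm (\<lambda>e. f (e 0))" and s: "dterm s" shows "dterm (\<lambda>e. f (s e))"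
  unfolding dterm_def
  by (rule pdef_app2[where R = "\<lambda>x y. x = f y", OF f[unfolded dterm_def] dterm_var dterm_shift[OF s]])

lemma dterm_app2:
  assumes f: "dterm (\<lambda>e. f (e 0) (e (Suc 0)))" and s: "dterm s" and t: "dterm t"
  shows "dterm (\<lambda>e. f (s e) (t e))"
  unfolding dterm_def
  by (rule pdef_app3[where R = "\<lambda>x y z. x = f y z",
        OF f[unfolded dterm_def] dterm_var dterm_shift[OF s] dterm_shift[OF t]])

lemma pdef_mem [dfn]: "dterm s \<Longrightarrow> dterm t \<Longrightarrow> pdef (\<lambda>e. E (s e) (t e))"
  by (rule pdef_app2[where R = E]) (intro pdef_definable definable_mem)

lemma pdef_eq [dfn]: "dterm s \<Longrightarrow> dterm t \<Longrightarrow> pdef (\<lambda>e. s e = t e)"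
  by (rule pdef_app2[where R = "(=)"]) (intro pdef_definable definable_eq)

lemma pdef_eqpoll [dfn]: "dterm s \<Longrightarrow> dterm t \<Longrightarrow> pdef (\<lambda>e. eqpoll_in E (s e) (t e))"
  by (rule pdef_app2[where R = "eqpoll_in E"]) (intro pdef_definable definable_eqpoll)

lemma pdef_finite [dfn]: "dterm s \<Longrightarrow> pdef (\<lambda>e. finite_in E (s e))"
  by (rule pdef_app1[where R = "finite_in E"]) (intro pdef_definable definable_finite)

lemma pdef_singleton [dfn]: "dterm s \<Longrightarrow> pdef (\<lambda>e. singleton_in E (s e))"
  by (rule pdef_app1[where R = "singleton_in E"]) (intro pdef_definable definable_singleton)

lemma pdef_sub [dfn]: "dterm s \<Longrightarrow> dterm t \<Longrightarrow> pdef (\<lambda>e. sub_in E (s e) (t e))"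
  by (rule pdef_app2[where R = "sub_in E"]) (unfold sub_in_def, intro dfn)

lemma dterm_pair [dfn]: "dterm s \<Longrightarrow> dterm t \<Longrightarrow> dterm (\<lambda>e. pair_in E (s e) (t e))"
  by (rule dterm_app2[where f = "pair_in E"])
    (unfold dterm_def, intro pdef_definable definable_eq_pair)

text \<open>By extensionality, a set-valued operation is definable as soon as its membership relation is.\<close>

lemma dterm_coll:
  assumes mem: "\<And>e z. E z (t e) \<longleftrightarrow> Q e z" and "pdef (\<lambda>e. Q (\<lambda>n. e (Suc n)) (e 0))"
  shows "dterm t"
proof -
  have "e 0 = t (\<lambda>n. e (Suc n)) \<longleftrightarrow> (\<forall>z. E z (e 0) \<longleftrightarrow> Q (\<lambda>n. e (Suc n)) z)" for e
    by (simp add: ext_iff[of "e 0"] mem)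
  then show ?thesis unfolding dterm_def by (simp only:) (intro dfn pdef_shift1 assms(2))
qed

section \<open>Set existence\<close>

definition small :: "('v \<Rightarrow> bool) \<Rightarrow> bool" where
  "small P \<longleftrightarrow> (\<exists>s. \<forall>x. E x s \<longleftrightarrow> P x)"

lemma mem_coll_small: "small P \<Longrightarrow> E x (coll E P) \<longleftrightarrow> P x"
  unfolding small_def by (rule mem_coll)

lemma small_mem: "small (\<lambda>x. E x s)"
  unfolding small_def by blast

text \<open>Separation, in the form in which it is used: a definable subclass of a set is a set.\<close>

lemma small_sub:
  assumes P: "pdef (\<lambda>e. P (e 0))" and "small Q" "\<And>x. P x \<Longrightarrow> Q x"
  shows "small P"
proof -
  obtain R c where R: "definable E R" "\<And>e. P (e 0) \<longleftrightarrow> R (mix c e)"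
    using P unfolding pdef_def by blast
  define r where "r n = (if even n then Suc (n div 2) else n div 2)" for n :: nat
  have "mix c (case_nat z c) = (\<lambda>n. case_nat z c (r n))" for z
  proof
    fix n show "mix c (case_nat z c) n = case_nat z c (r n)"
      by (simp add: mix_def r_def)
  qed
  then have "P z \<longleftrightarrow> R (\<lambda>n. case_nat z c (r n))" for z
    using R(2)[of "case_nat z c"] by simp
  moreover obtain s where "\<forall>x. E x s \<longleftrightarrow> Q x" using assms(2) unfolding small_def by blast
  ultimately show ?thesis
    using definable_separation[OF definable_rename[OF R(1), of r], of s c] assms(3)
    unfolding small_def by metis
qed

lemma small_un:
  assumes "small P" "small Q" shows "small (\<lambda>x. P x \<or> Q x)"
proof -
  obtain s t where s: "\<forall>x. E x s \<longleftrightarrow> P x" and t: "\<forall>x. E x t \<longleftrightarrow> Q x"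
    using assms unfolding small_def by blast
  obtain u where "\<forall>z. E z u \<longleftrightarrow> (\<exists>y. E z y \<and> E y (upair_in E s t))" using union by blast
  then show ?thesis unfolding small_def using s t by (intro exI[of _ u]) auto
qed

lemma small_Union: "small (\<lambda>x. \<exists>y. E x y \<and> E y s)"
  unfolding small_def using union by blast

lemma small_eq: "small (\<lambda>x. x = a)"
  unfolding small_def using pairing[of a a] by simp

definition cons :: "'v \<Rightarrow> 'v \<Rightarrow> 'v" where
  "cons a S = coll E (\<lambda>z. E z S \<or> z = a)"

lemma mem_cons [simp]: "E z (cons a S) \<longleftrightarrow> E z S \<or> z = a"
  unfolding cons_def by (intro mem_coll_small small_un small_mem small_eq)

lemma dterm_cons [dfn]: "dterm s \<Longrightarrow> dterm t \<Longrightarrow> dterm (\<lambda>e. cons (s e) (t e))"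
  by (rule dterm_app2[where f = cons]) (rule dterm_coll, rule mem_cons, intro dfn)

definition sdiff :: "'v \<Rightarrow> 'v \<Rightarrow> 'v" where
  "sdiff S T = coll E (\<lambda>z. E z S \<and> \<not> E z T)"

lemma mem_sdiff [simp]: "E z (sdiff S T) \<longleftrightarrow> E z S \<and> \<not> E z T"
  unfolding sdiff_def by (rule mem_coll_small, rule small_sub[OF _ small_mem[of S]]) (intro dfn, simp)

lemma dterm_sdiff [dfn]: "dterm s \<Longrightarrow> dterm t \<Longrightarrow> dterm (\<lambda>e. sdiff (s e) (t e))"
  by (rule dterm_app2[where f = sdiff]) (rule dterm_coll, rule mem_sdiff, intro dfn)

definition del :: "'v \<Rightarrow> 'v \<Rightarrow> 'v" where
  "del a S = coll E (\<lambda>z. E z S \<and> z \<noteq> a)"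

lemma mem_del [simp]: "E z (del a S) \<longleftrightarrow> E z S \<and> z \<noteq> a"
  unfolding del_def by (rule mem_coll_small, rule small_sub[OF _ small_mem[of S]]) (intro dfn, simp)

lemma dterm_del [dfn]: "dterm s \<Longrightarrow> dterm t \<Longrightarrow> dterm (\<lambda>e. del (s e) (t e))"
  by (rule dterm_app2[where f = del]) (rule dterm_coll, rule mem_del, intro dfn)

definition un :: "'v \<Rightarrow> 'v \<Rightarrow> 'v" where
  "un S T = coll E (\<lambda>z. E z S \<or> E z T)"

lemma mem_un [simp]: "E z (un S T) \<longleftrightarrow> E z S \<or> E z T"
  unfolding un_def by (intro mem_coll_small small_un small_mem)

lemma dterm_un [dfn]: "dterm s \<Longrightarrow> dterm t \<Longrightarrow> dterm (\<lambda>e. un (s e) (t e))"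
  by (rule dterm_app2[where f = un]) (rule dterm_coll, rule mem_un, intro dfn)

definition union_of :: "'v \<Rightarrow> 'v" where
  "union_of S = coll E (\<lambda>z. \<exists>y. E z y \<and> E y S)"

lemma mem_union_of [simp]: "E z (union_of S) \<longleftrightarrow> (\<exists>y. E z y \<and> E y S)"
  unfolding union_of_def by (intro mem_coll_small small_Union)

lemma dterm_union_of [dfn]: "dterm s \<Longrightarrow> dterm (\<lambda>e. union_of (s e))"
  by (rule dterm_app1[where f = union_of]) (rule dterm_coll, rule mem_union_of, intro dfn)

lemma dterm_succ [dfn]: "dterm s \<Longrightarrow> dterm (\<lambda>e. succ_in E (s e))"
  by (rule dterm_app1[where f = "succ_in E"]) (rule dterm_coll, rule mem_succ, intro dfn)

lemma dterm_Pow [dfn]: "dterm s \<Longrightarrow> dterm (\<lambda>e. Pow_in E (s e))"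
  by (rule dterm_app1[where f = "Pow_in E"]) (rule dterm_coll, rule mem_Pow, intro dfn)

text \<open>Replacement for a definable operation.\<close>

lemma small_image:
  assumes "dterm (\<lambda>e. f (e 0))" shows "small (\<lambda>z. \<exists>x. E x S \<and> z = f x)"
proof -
  obtain R c where R: "definable E R" "\<And>e. e 0 = f (e (Suc 0)) \<longleftrightarrow> R (mix c e)"
    using assms unfolding dterm_def pdef_def by auto
  \<comment> \<open>Replacement puts the argument at position 0, the value at 1 and the parameters after them, whereas
     in the graph of a term the value comes first. All other variables are irrelevant and are sent
     to the argument.\<close>
  define r where "r n = (if even n then Suc (Suc (n div 2)) else if n = 1 then 1 else 0)" for n :: nat
  let ?R = "\<lambda>e. R (mix (\<lambda>n. e (Suc (Suc n))) (case_nat (e 1) (\<lambda>_. e 0)))"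
  have "mix (\<lambda>n. e (Suc (Suc n))) (case_nat (e 1) (\<lambda>_. e 0)) = (\<lambda>n. e (r n))" for e :: "nat \<Rightarrow> 'v"
  proof
    fix n show "mix (\<lambda>n. e (Suc (Suc n))) (case_nat (e 1) (\<lambda>_. e 0)) n = e (r n)"
    proof (cases "even n")
      case False then obtain k where "n = Suc (2 * k)" by (metis oddE Suc_eq_plus1)
      then show ?thesis by (cases k) (simp_all add: mix_def r_def)
    qed (simp add: mix_def r_def)
  qed
  then have "definable E ?R" using definable_rename[OF R(1), of r] by simp
  then obtain p where p: "\<And>e. ?R e \<longleftrightarrow> sat E e p" unfolding definable_def by blast
  have "sat E (case_nat y (case_nat z c)) p \<longleftrightarrow> z = f y" for y z
    unfolding p[symmetric] using R(2)[of "case_nat z (\<lambda>_. y)"] by simp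
  then show ?thesis unfolding small_def using replacement[of S c p] by simp
qed

lemma small_comp:
  assumes "pdef (\<lambda>e. P (e 0))" shows "small (\<lambda>x. E x S \<and> P x)"
  by (rule small_sub[OF _ small_mem[of S]]) (intro dfn assms, simp)

abbreviation mem_in (infix "\<epsilon>" 50) where "x \<epsilon> y \<equiv> E x y"
abbreviation eqp (infix "\<approx>" 50) where "x \<approx> y \<equiv> eqpoll_in E x y"
abbreviation sub (infix "\<sqsubseteq>" 50) where "x \<sqsubseteq> y \<equiv> sub_in E x y"
abbreviation fin where "fin x \<equiv> finite_in E x"
abbreviation emp ("\<zero>") where "\<zero> \<equiv> empty_in E"

section \<open>Bijections\<close>

lemma mem_irrefl: "\<not> x \<epsilon> x"
  using foundation[of "upair_in E x x"] by auto

lemma mem_asym: "x \<epsilon> y \<Longrightarrow> \<not> y \<epsilon> x"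
  using foundation[of "upair_in E x y"] by auto

lemma small_pairs: "small (\<lambda>p. \<exists>x y. x \<epsilon> S \<and> y \<epsilon> T \<and> p = pair_in E x y)"
  by (rule small_sub[OF _ small_mem[of "Pow_in E (Pow_in E (un S T))"]])
    (intro dfn, auto simp: sub_in_def pair_in_def)

text \<open>
  A first-order form of bijectivity for class relations without unique existence, which is easier
  to reason with. By \<open>eqpollI\<close> a definable relation suffices for an equipollence, so no bijection has to
  be constructed as a set of pairs again.
\<close>

definition biject :: "('v \<Rightarrow> 'v \<Rightarrow> bool) \<Rightarrow> 'v \<Rightarrow> 'v \<Rightarrow> bool" where
  "biject G S T \<longleftrightarrow> (\<forall>x y. G x y \<longrightarrow> x \<epsilon> S \<and> y \<epsilon> T) \<and>
     (\<forall>x. x \<epsilon> S \<longrightarrow> (\<exists>y. G x y)) \<and> (\<forall>y. y \<epsilon> T \<longrightarrow> (\<exists>x. G x y)) \<and>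
     (\<forall>x y y'. G x y \<and> G x y' \<longrightarrow> y = y') \<and> (\<forall>x x' y. G x y \<and> G x' y \<longrightarrow> x = x')"

lemma eqpollI:
  assumes G: "pdef (\<lambda>e. G (e 0) (e (Suc 0)))" and bij: "biject G S T" shows "S \<approx> T"
proof -
  define f where "f = coll E (\<lambda>p. \<exists>x y. p = pair_in E x y \<and> G x y)"
  have mem: "p \<epsilon> f \<longleftrightarrow> (\<exists>x y. p = pair_in E x y \<and> G x y)" for p
    unfolding f_def
  proof (rule mem_coll_small, rule small_sub[OF _ small_pairs[of S T]])
    show "pdef (\<lambda>e. \<exists>x y. e 0 = pair_in E x y \<and> G x y)" by (intro dfn pdef_app2[OF G])
  qed (use bij in \<open>unfold biject_def, blast\<close>)
  have pair: "pair_in E x y \<epsilon> f \<longleftrightarrow> G x y" for x y by (simp add: mem)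
  have "bij_in E f S T"
    unfolding bij_in_def pair
  proof (intro conjI allI impI)
    show "\<exists>x y. x \<epsilon> S \<and> y \<epsilon> T \<and> p = pair_in E x y" if "p \<epsilon> f" for p
      using that bij unfolding mem biject_def by blast
    show "\<exists>!y. G x y" if "x \<epsilon> S" for x using that bij unfolding biject_def by blast
    show "\<exists>!x. G x y" if "y \<epsilon> T" for y using that bij unfolding biject_def by blast
  qed
  then show ?thesis unfolding eqpoll_in_def by blast
qed

lemma eqpollE:
  assumes "S \<approx> T" obtains f where "biject (\<lambda>x y. pair_in E x y \<epsilon> f) S T"
proof -
  obtain f where f: "bij_in E f S T" using assms unfolding eqpoll_in_def by blast
  have dom: "x \<epsilon> S \<and> y \<epsilon> T" if xy: "pair_in E x y \<epsilon> f" for x y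
  proof -
    obtain x' y' where "x' \<epsilon> S" "y' \<epsilon> T" "pair_in E x y = pair_in E x' y'"
      using f xy unfolding bij_in_def by blast
    then show ?thesis by simp
  qed
  have "biject (\<lambda>x y. pair_in E x y \<epsilon> f) S T"
    unfolding biject_def
  proof (intro conjI allI impI)
    show "\<exists>y. pair_in E x y \<epsilon> f" if "x \<epsilon> S" for x using f that unfolding bij_in_def by blast
    show "\<exists>x. pair_in E x y \<epsilon> f" if "y \<epsilon> T" for y using f that unfolding bij_in_def by blast
    show "y = y'" if "pair_in E x y \<epsilon> f \<and> pair_in E x y' \<epsilon> f" for x y y'
      using f that dom unfolding bij_in_def by blast
    show "x = x'" if "pair_in E x y \<epsilon> f \<and> pair_in E x' y \<epsilon> f" for x x' y
      using f that dom unfolding bij_in_def by blast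
  qed (use dom in blast)+
  then show ?thesis by (rule that)
qed

lemma eqpoll_sym: assumes "S \<approx> T" shows "T \<approx> S"
proof -
  obtain f where f: "biject (\<lambda>x y. pair_in E x y \<epsilon> f) S T" using assms by (rule eqpollE)
  show ?thesis
  proof (rule eqpollI)
    show "biject (\<lambda>x y. pair_in E y x \<epsilon> f) T S" using f unfolding biject_def by blast
  qed (intro dfn)
qed

lemma eqpoll_refl: "S \<approx> S"
proof (rule eqpollI)
  show "biject (\<lambda>x y. x = y \<and> x \<epsilon> S) S S" unfolding biject_def by blast
qed (intro dfn)

lemma eqpoll_trans: assumes "S \<approx> T" "T \<approx> U" shows "S \<approx> U"
proof -
  obtain f where f: "biject (\<lambda>x y. pair_in E x y \<epsilon> f) S T" using assms(1) by (rule eqpollE)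
  obtain g where g: "biject (\<lambda>x y. pair_in E x y \<epsilon> g) T U" using assms(2) by (rule eqpollE)
  show ?thesis
  proof (rule eqpollI)
    show "biject (\<lambda>x z. \<exists>y. pair_in E x y \<epsilon> f \<and> pair_in E y z \<epsilon> g) S U"
      unfolding biject_def
    proof (intro conjI allI impI)
      fix x assume "x \<epsilon> S"
      then obtain y where y: "pair_in E x y \<epsilon> f" using f unfolding biject_def by blast
      then have "y \<epsilon> T" using f unfolding biject_def by blast
      then obtain z where "pair_in E y z \<epsilon> g" using g unfolding biject_def by blast
      then show "\<exists>z y. pair_in E x y \<epsilon> f \<and> pair_in E y z \<epsilon> g" using y by blast
    next
      fix z assume "z \<epsilon> U"
      then obtain y where y: "pair_in E y z \<epsilon> g" using g unfolding biject_def by blast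
      then have "y \<epsilon> T" using g unfolding biject_def by blast
      then obtain x where "pair_in E x y \<epsilon> f" using f unfolding biject_def by blast
      then show "\<exists>x y. pair_in E x y \<epsilon> f \<and> pair_in E y z \<epsilon> g" using y by blast
    next
      fix x z z' assume "(\<exists>y. pair_in E x y \<epsilon> f \<and> pair_in E y z \<epsilon> g) \<and>
        (\<exists>y. pair_in E x y \<epsilon> f \<and> pair_in E y z' \<epsilon> g)"
      then obtain y y' where "pair_in E x y \<epsilon> f" "pair_in E y z \<epsilon> g"
        "pair_in E x y' \<epsilon> f" "pair_in E y' z' \<epsilon> g" by blast
      moreover from this have "y = y'" using f unfolding biject_def by blast
      ultimately show "z = z'" using g unfolding biject_def by blast
    next
      fix x x' z assume "(\<exists>y. pair_in E x y \<epsilon> f \<and> pair_in E y z \<epsilon> g) \<and>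
        (\<exists>y. pair_in E x' y \<epsilon> f \<and> pair_in E y z \<epsilon> g)"
      then obtain y y' where "pair_in E x y \<epsilon> f" "pair_in E y z \<epsilon> g"
        "pair_in E x' y' \<epsilon> f" "pair_in E y' z \<epsilon> g" by blast
      moreover from this have "y = y'" using g unfolding biject_def by blast
      ultimately show "x = x'" using f unfolding biject_def by blast
    qed (use f g in \<open>unfold biject_def, blast\<close>)+
  qed (intro dfn)
qed

lemma eqpoll_empty: "S \<approx> \<zero> \<Longrightarrow> S = \<zero>"
  by (erule eqpollE, rule extensionality) (auto simp: biject_def)

lemma eqpoll_cons:
  assumes "S \<approx> T" "\<not> a \<epsilon> S" "\<not> b \<epsilon> T" shows "cons a S \<approx> cons b T"
proof -
  obtain f where f: "biject (\<lambda>x y. pair_in E x y \<epsilon> f) S T" using assms(1) by (rule eqpollE)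
  show ?thesis
  proof (rule eqpollI)
    show "biject (\<lambda>x y. pair_in E x y \<epsilon> f \<or> x = a \<and> y = b) (cons a S) (cons b T)"
      using f assms(2,3) unfolding biject_def mem_cons by blast
  qed (intro dfn)
qed

text \<open>
  Below, bijections between finite sets are compared one element at a time, by this lemma and
  \<open>eqpoll_cons\<close>.
\<close>

lemma eqpoll_del:
  assumes "S \<approx> T" "a \<epsilon> S" "b \<epsilon> T" shows "del a S \<approx> del b T"
proof -
  obtain f where "biject (\<lambda>x y. pair_in E x y \<epsilon> f) S T" using assms(1) by (rule eqpollE)
  then have
    dom: "\<And>x y. pair_in E x y \<epsilon> f \<Longrightarrow> x \<epsilon> S \<and> y \<epsilon> T" and
    tot: "\<And>x. x \<epsilon> S \<Longrightarrow> \<exists>y. pair_in E x y \<epsilon> f" and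
    sur: "\<And>y. y \<epsilon> T \<Longrightarrow> \<exists>x. pair_in E x y \<epsilon> f" and
    func: "\<And>x y y'. pair_in E x y \<epsilon> f \<Longrightarrow> pair_in E x y' \<epsilon> f \<Longrightarrow> y = y'" and
    inj: "\<And>x x' y. pair_in E x y \<epsilon> f \<Longrightarrow> pair_in E x' y \<epsilon> f \<Longrightarrow> x = x'"
    unfolding biject_def by blast+
  \<comment> \<open>The preimage of \<open>b\<close> is redirected to the image of \<open>a\<close>.\<close>
  let ?G = "\<lambda>x y. x \<noteq> a \<and> y \<noteq> b \<and>
          (pair_in E x y \<epsilon> f \<or> pair_in E x b \<epsilon> f \<and> pair_in E a y \<epsilon> f)"
  show ?thesis
  proof (rule eqpollI)
    show "biject ?G (del a S) (del b T)"
      unfolding biject_def mem_del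
    proof (intro conjI allI impI)
      fix x assume x: "x \<epsilon> S \<and> x \<noteq> a"
      then obtain y where y: "pair_in E x y \<epsilon> f" using tot by blast
      obtain z where z: "pair_in E a z \<epsilon> f" using tot assms(2) by blast
      have "z \<noteq> b" if "y = b" using inj[OF y] z x that by blast
      then show "\<exists>y. ?G x y" using x y z by (cases "y = b") blast+
    next
      fix y assume y: "y \<epsilon> T \<and> y \<noteq> b"
      then obtain x where x: "pair_in E x y \<epsilon> f" using sur by blast
      obtain z where z: "pair_in E z b \<epsilon> f" using sur assms(3) by blast
      have "z \<noteq> a" if "x = a" using func[OF x] z y that by blast
      then show "\<exists>x. ?G x y" using x y z by (cases "x = a") blast+
    next
      fix x y y' assume "?G x y \<and> ?G x y'" then show "y = y'" using func by blast
    next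
      fix x x' y assume "?G x y \<and> ?G x' y" then show "x = x'" using inj by blast
    qed (use dom in blast)+
  qed (intro dfn)
qed

lemma del_cons [simp]: "\<not> a \<epsilon> S \<Longrightarrow> del a (cons a S) = S"
  by (rule extensionality) auto

lemma cons_del [simp]: "a \<epsilon> S \<Longrightarrow> cons a (del a S) = S"
  by (rule extensionality) auto

lemma eqpoll_cons_left:
  assumes "cons a S \<approx> T" "\<not> a \<epsilon> S"
  obtains b where "b \<epsilon> T" "S \<approx> del b T"
proof -
  obtain f where f: "biject (\<lambda>x y. pair_in E x y \<epsilon> f) (cons a S) T"
    using assms(1) by (rule eqpollE)
  have "a \<epsilon> cons a S" by simp
  then obtain b where b: "b \<epsilon> T" using f unfolding biject_def by blast
  have "S \<approx> del b T" using eqpoll_del[OF assms(1) _ b, of a] assms(2) by simp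
  with b show ?thesis by (rule that)
qed

section \<open>Finite sets\<close>

lemma pdef_inductive [dfn]: "dterm s \<Longrightarrow> pdef (\<lambda>e. inductive_in E (s e))"
  by (rule pdef_app1[where R = "inductive_in E"]) (intro pdef_definable definable_inductive)

lemma nat_zero: "nat_in E \<zero>"
  unfolding nat_in_def inductive_in_def by blast

lemma nat_succ: "nat_in E n \<Longrightarrow> nat_in E (succ_in E n)"
  unfolding nat_in_def inductive_in_def by blast

lemma nat_induct_in:
  assumes "nat_in E n" and P: "pdef (\<lambda>e. P (e 0))" and "P \<zero>"
    and step: "\<And>n. nat_in E n \<Longrightarrow> P n \<Longrightarrow> P (succ_in E n)"
  shows "P n"
proof -
  obtain I where I: "inductive_in E I" using nonempty_inductive by blast
  have "small (\<lambda>n. n \<epsilon> I \<and> nat_in E n \<and> P n)"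
    unfolding nat_in_def by (rule small_comp) (intro dfn P)
  then obtain J where J: "\<And>n. n \<epsilon> J \<longleftrightarrow> n \<epsilon> I \<and> nat_in E n \<and> P n"
    unfolding small_def by blast
  have "inductive_in E J"
    using I assms nat_zero nat_succ unfolding inductive_in_def J by blast
  then show ?thesis using assms(1) J unfolding nat_in_def by blast
qed

lemma fin_empty: "fin \<zero>"
  unfolding finite_in_def using nat_zero eqpoll_refl by blast

lemma succ_eq_cons: "succ_in E n = cons n n"
  by (rule extensionality) auto

lemma cons_absorb: "a \<epsilon> S \<Longrightarrow> cons a S = S"
  by (rule extensionality) auto

lemma fin_cons: assumes "fin S" shows "fin (cons a S)"
proof (cases "a \<epsilon> S")
  case True then show ?thesis using assms cons_absorb by simp
next
  case False
  obtain n where "nat_in E n" "S \<approx> n" using assms unfolding finite_in_def by blast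
  then have "cons a S \<approx> succ_in E n" "nat_in E (succ_in E n)"
    using eqpoll_cons False mem_irrefl nat_succ by (auto simp: succ_eq_cons)
  then show ?thesis unfolding finite_in_def by blast
qed

text \<open>
  Finiteness in the structure may differ from finiteness outside, so the finite
  sets of HOL are of no use here. The induction runs over the internal natural numbers, and \<open>P\<close> has
  to be definable.
\<close>

lemma fin_induct [consumes 1, case_names definable empty cons]:
  assumes "fin S" and P: "pdef (\<lambda>e. P (e 0))" and "P \<zero>"
    and step: "\<And>S a. fin S \<Longrightarrow> \<not> a \<epsilon> S \<Longrightarrow> P S \<Longrightarrow> P (cons a S)"
  shows "P S"
proof -
  obtain n where n: "nat_in E n" "S \<approx> n" using assms(1) unfolding finite_in_def by blast
  from n(1) have "\<forall>S. S \<approx> n \<longrightarrow> fin S \<and> P S"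
  proof (rule nat_induct_in)
    show "pdef (\<lambda>e. \<forall>S. S \<approx> e 0 \<longrightarrow> fin S \<and> P S)"
      by (intro dfn pdef_app1[OF P])
    show "\<forall>S. S \<approx> \<zero> \<longrightarrow> fin S \<and> P S"
      using eqpoll_empty fin_empty assms(3) by blast
    fix n assume IH: "\<forall>S. S \<approx> n \<longrightarrow> fin S \<and> P S"
    show "\<forall>S. S \<approx> succ_in E n \<longrightarrow> fin S \<and> P S"
    proof (intro allI impI)
      fix S assume "S \<approx> succ_in E n"
      then have "cons n n \<approx> S" using eqpoll_sym by (simp add: succ_eq_cons)
      then obtain b where b: "b \<epsilon> S" "n \<approx> del b S" using eqpoll_cons_left mem_irrefl by blast
      then have "fin (del b S) \<and> P (del b S)" using IH eqpoll_sym by blast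
      then show "fin S \<and> P S" using fin_cons[of "del b S" b] step[of "del b S" b] b(1) by simp
    qed
  qed
  with n(2) show ?thesis by blast
qed

lemma fin_sub: assumes "fin S" "T \<sqsubseteq> S" shows "fin T"
proof -
  from assms(1) have "\<forall>T. T \<sqsubseteq> S \<longrightarrow> fin T"
  proof (induction rule: fin_induct)
    case definable show ?case by (intro dfn)
  next
    case empty
    have "T = \<zero>" if "T \<sqsubseteq> \<zero>" for T
      by (rule extensionality) (use that in \<open>auto simp: sub_in_def\<close>)
    then show ?case using fin_empty by blast
  next
    case (cons S a)
    show ?case
    proof (intro allI impI)
      fix T assume "T \<sqsubseteq> cons a S"
      then have "del a T \<sqsubseteq> S" by (auto simp: sub_in_def)
      then have "fin (del a T)" using cons(3) by blast
      moreover have "del a T = T" if "\<not> a \<epsilon> T" by (rule extensionality) (use that in auto)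
      ultimately show "fin T" using fin_cons[of "del a T" a] cons_del[of a T] by (cases "a \<epsilon> T") auto
    qed
  qed
  then show ?thesis using assms(2) by blast
qed

lemma fin_un: assumes "fin T" "fin S" shows "fin (un S T)"
  using assms(1)
proof (induction rule: fin_induct)
  case definable show ?case by (intro dfn)
next
  case empty have "un S \<zero> = S" by (rule extensionality) auto
  then show ?case using assms(2) by simp
next
  case (cons T a)
  have "un S (cons a T) = cons a (un S T)" by (rule extensionality) auto
  then show ?case using cons fin_cons by simp
qed

lemma fin_image:
  assumes "fin S" and f: "dterm (\<lambda>e. f (e 0))" and "\<And>y. y \<epsilon> T \<Longrightarrow> \<exists>x. x \<epsilon> S \<and> y = f x"
  shows "fin T"
proof -
  from assms(1) have "\<forall>T. (\<forall>y. y \<epsilon> T \<longrightarrow> (\<exists>x. x \<epsilon> S \<and> y = f x)) \<longrightarrow> fin T"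
  proof (induction rule: fin_induct)
    case definable show ?case by (intro dfn dterm_app1[OF f])
  next
    case empty
    have "T = \<zero>" if "\<forall>y. y \<epsilon> T \<longrightarrow> (\<exists>x. x \<epsilon> \<zero> \<and> y = f x)" for T
      by (rule extensionality) (use that in auto)
    then show ?case using fin_empty by blast
  next
    case (cons S a)
    show ?case
    proof (intro allI impI)
      fix T assume T: "\<forall>y. y \<epsilon> T \<longrightarrow> (\<exists>x. x \<epsilon> cons a S \<and> y = f x)"
      then have "\<forall>y. y \<epsilon> del (f a) T \<longrightarrow> (\<exists>x. x \<epsilon> S \<and> y = f x)" by auto
      then have "fin (del (f a) T)" using cons(3) by blast
      then have "fin (cons (f a) (del (f a) T))" by (rule fin_cons)
      then show "fin T" by (rule fin_sub) (auto simp: sub_in_def)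
    qed
  qed
  then show ?thesis using assms(3) by blast
qed

lemma fin_Pow: assumes "fin S" shows "fin (Pow_in E S)"
  using assms
proof (induction rule: fin_induct)
  case definable show ?case by (intro dfn)
next
  case empty
  have "Pow_in E \<zero> = cons \<zero> \<zero>"
  proof (rule extensionality, intro allI)
    fix z show "z \<epsilon> Pow_in E \<zero> \<longleftrightarrow> z \<epsilon> cons \<zero> \<zero>"
      using ext_iff[of z \<zero>] by (auto simp: sub_in_def)
  qed
  then show ?case using fin_cons fin_empty by simp
next
  case (cons S a)
  obtain I where I: "\<And>z. z \<epsilon> I \<longleftrightarrow> (\<exists>x. x \<epsilon> Pow_in E S \<and> z = cons a x)"
    using small_image[of "cons a" "Pow_in E S"] dterm_cons[OF dterm_const dterm_var]
    unfolding small_def by blast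
  have "fin I" by (rule fin_image[OF cons(3), of "cons a"]) (intro dfn, use I in blast)
  then have "fin (un I (Pow_in E S))" using fin_un cons(3) by blast
  then show ?case
  proof (rule fin_sub)
    show "Pow_in E (cons a S) \<sqsubseteq> un I (Pow_in E S)"
      unfolding sub_in_def[of E "Pow_in E (cons a S)"]
    proof (intro allI impI)
      fix z assume z: "z \<epsilon> Pow_in E (cons a S)"
      show "z \<epsilon> un I (Pow_in E S)"
      proof (cases "a \<epsilon> z")
        case True then have "z = cons a (del a z)" by simp
        moreover have "del a z \<epsilon> Pow_in E S" using z by (auto simp: sub_in_def)
        ultimately show ?thesis using I by auto
      next
        case False then show ?thesis using z by (auto simp: sub_in_def)
      qed
    qed
  qed
qed

lemma fin_nonsub:
  assumes "\<not> fin A" "fin U" obtains a where "a \<epsilon> A" "\<not> a \<epsilon> U"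
  using assms fin_sub unfolding sub_in_def by blast

section \<open>Counting finite sets\<close>

lemma pigeonhole:
  assumes "fin S" "S \<approx> T" "T \<sqsubseteq> S" shows "T = S"
proof -
  from assms(1) have "\<forall>T. T \<sqsubseteq> S \<and> S \<approx> T \<longrightarrow> T = S"
  proof (induction rule: fin_induct)
    case definable show ?case by (intro dfn)
  next
    case empty then show ?case using eqpoll_empty eqpoll_sym by blast
  next
    case (cons S a)
    show ?case
    proof (intro allI impI, elim conjE)
      fix T assume T: "T \<sqsubseteq> cons a S" "cons a S \<approx> T"
      show "T = cons a S"
      proof (cases "a \<epsilon> T")
        case True
        then have "S \<approx> del a T" using eqpoll_del[OF T(2), of a a] cons(2) by simp
        moreover have "del a T \<sqsubseteq> S" using T(1) by (auto simp: sub_in_def)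
        ultimately have "del a T = S" using cons(3) by blast
        then show ?thesis using cons_del[OF True] by simp
      next
        case False
        then have TS: "T \<sqsubseteq> S" using T(1) by (auto simp: sub_in_def)
        obtain b where b: "b \<epsilon> T" "S \<approx> del b T" using eqpoll_cons_left T(2) cons(2) by blast
        have "del b T \<sqsubseteq> S" using TS by (auto simp: sub_in_def)
        then have "del b T = S" using cons(3) b(2) by blast
        then show ?thesis using b(1) TS by (auto simp: sub_in_def)
      qed
    qed
  qed
  then show ?thesis using assms by blast
qed

lemma eqpoll_cancel:
  assumes "fin B" "un X B \<approx> un Y B" "\<And>z. z \<epsilon> B \<Longrightarrow> \<not> z \<epsilon> X \<and> \<not> z \<epsilon> Y"
  shows "X \<approx> Y"
proof -
  from assms(1) have "un X B \<approx> un Y B \<and> (\<forall>z. z \<epsilon> B \<longrightarrow> \<not> z \<epsilon> X \<and> \<not> z \<epsilon> Y) \<longrightarrow> X \<approx> Y"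
  proof (induction rule: fin_induct)
    case definable show ?case by (intro dfn)
  next
    case empty
    have "un X \<zero> = X" "un Y \<zero> = Y" by (rule extensionality, simp)+
    then show ?case by simp
  next
    case (cons B a)
    show ?case
    proof
      assume *: "un X (cons a B) \<approx> un Y (cons a B) \<and>
        (\<forall>z. z \<epsilon> cons a B \<longrightarrow> \<not> z \<epsilon> X \<and> \<not> z \<epsilon> Y)"
      have "un X B = del a (un X (cons a B))" "un Y B = del a (un Y (cons a B))"
        by (rule extensionality, use * cons(2) in auto)+
      then have "un X B \<approx> un Y B" using eqpoll_del * by simp
      then show "X \<approx> Y" using cons(3) * by simp
    qed
  qed
  then show ?thesis using assms by blast
qed

lemma eqpoll_subset:
  assumes "fin S" "S \<approx> T" "R \<sqsubseteq> S" shows "\<exists>R'. R' \<sqsubseteq> T \<and> R \<approx> R'"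
proof -
  from assms(1) have "\<forall>T R. S \<approx> T \<and> R \<sqsubseteq> S \<longrightarrow> (\<exists>R'. R' \<sqsubseteq> T \<and> R \<approx> R')"
  proof (induction rule: fin_induct)
    case definable show ?case by (intro dfn)
  next
    case empty
    have "R = \<zero>" if "R \<sqsubseteq> \<zero>" for R by (rule extensionality) (use that in \<open>auto simp: sub_in_def\<close>)
    then show ?case using eqpoll_refl unfolding sub_in_def by (metis mem_empty)
  next
    case (cons S a)
    show ?case
    proof (intro allI impI, elim conjE)
      fix T R assume T: "cons a S \<approx> T" and R: "R \<sqsubseteq> cons a S"
      obtain b where b: "b \<epsilon> T" "S \<approx> del b T" using eqpoll_cons_left T cons(2) by blast
      have "del a R \<sqsubseteq> S" using R by (auto simp: sub_in_def)
      then obtain R' where R': "R' \<sqsubseteq> del b T" "del a R \<approx> R'" using cons(3) b(2) by blast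
      show "\<exists>R'. R' \<sqsubseteq> T \<and> R \<approx> R'"
      proof (cases "a \<epsilon> R")
        case True
        have "\<not> b \<epsilon> R'" using R'(1) by (auto simp: sub_in_def)
        then have "R \<approx> cons b R'" using eqpoll_cons[OF R'(2), of a b] True by simp
        moreover have "cons b R' \<sqsubseteq> T" using R'(1) b(1) by (auto simp: sub_in_def)
        ultimately show ?thesis by blast
      next
        case False then have "del a R = R" by (intro extensionality) auto
        then show ?thesis using R' by (auto simp: sub_in_def)
      qed
    qed
  qed
  then show ?thesis using assms by blast
qed

lemma fin_eqpoll: assumes "fin S" "S \<approx> T" shows "fin T"
  using assms eqpoll_sym eqpoll_trans unfolding finite_in_def by blast

text \<open>
  Evenness by halving avoids internal arithmetic. All that matters is that it alternates when
  elements are added one by one (\<open>even_cons\<close>), which makes it additive modulo 2 (\<open>even_un\<close>).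
\<close>

definition even_in :: "'v \<Rightarrow> bool" where
  "even_in S \<longleftrightarrow> (\<exists>h. h \<sqsubseteq> S \<and> h \<approx> sdiff S h)"

lemma pdef_even [dfn]: "dterm s \<Longrightarrow> pdef (\<lambda>e. even_in (s e))"
  by (rule pdef_app1[where R = even_in]) (unfold even_in_def, intro dfn)

lemma even_empty: "even_in \<zero>"
proof -
  have "sdiff \<zero> \<zero> = \<zero>" by (rule extensionality) auto
  then show ?thesis unfolding even_in_def using eqpoll_refl[of \<zero>]
    by (intro exI[of _ \<zero>]) (auto simp: sub_in_def)
qed

lemma not_even_single: "\<not> even_in (cons a \<zero>)"
proof
  assume "even_in (cons a \<zero>)"
  then obtain h where h: "h \<sqsubseteq> cons a \<zero>" "h \<approx> sdiff (cons a \<zero>) h" unfolding even_in_def by blast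
  show False
  proof (cases "a \<epsilon> h")
    case True
    then have "sdiff (cons a \<zero>) h = \<zero>" by (intro extensionality) (auto simp: sub_in_def)
    then have "h = \<zero>" using h(2) eqpoll_empty by simp
    then show False using True by simp
  next
    case False
    then have "h = \<zero>" using h(1) by (intro extensionality) (auto simp: sub_in_def)
    then have "sdiff (cons a \<zero>) h = \<zero>" using h(2) eqpoll_empty eqpoll_sym by simp
    then show False using False mem_sdiff[of a "cons a \<zero>" h] by simp
  qed
qed

text \<open>
  The step of the induction that proves the alternation. For the converse direction, if \<open>a\<close> and \<open>b\<close> lie
  in different halves, both can be deleted. If they lie in the same half \<open>k\<close>, then deleting \<open>a\<close> from
  \<open>k\<close> and some \<open>c\<close> from the other half keeps the halves equipollent, and \<open>c\<close> takes the place of \<open>b\<close>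
  in \<open>k\<close>.
\<close>

lemma even_cons_cons:
  assumes "\<not> a \<epsilon> S" "\<not> b \<epsilon> S" "a \<noteq> b"
  shows "even_in (cons a (cons b S)) \<longleftrightarrow> even_in S"
proof
  assume "even_in S"
  then obtain h where h: "h \<sqsubseteq> S" "h \<approx> sdiff S h" unfolding even_in_def by blast
  have "cons a h \<approx> cons b (sdiff S h)"
    by (rule eqpoll_cons[OF h(2)]) (use h(1) assms in \<open>auto simp: sub_in_def\<close>)
  moreover have "cons b (sdiff S h) = sdiff (cons a (cons b S)) (cons a h)"
    by (rule extensionality) (use h(1) assms in \<open>auto simp: sub_in_def\<close>)
  ultimately show "even_in (cons a (cons b S))"
    unfolding even_in_def by (intro exI[of _ "cons a h"]) (use h(1) in \<open>auto simp: sub_in_def\<close>)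
next
  assume "even_in (cons a (cons b S))"
  then obtain h where h: "h \<sqsubseteq> cons a (cons b S)" "h \<approx> sdiff (cons a (cons b S)) h"
    unfolding even_in_def by blast
  let ?k = "sdiff (cons a (cons b S)) h"
  have opposite: "even_in S" if "k \<approx> l" "c \<epsilon> k" "d \<epsilon> l" "c = a \<and> d = b \<or> c = b \<and> d = a"
     and S: "\<And>z. z \<epsilon> cons a (cons b S) \<longleftrightarrow> z \<epsilon> k \<or> z \<epsilon> l" "\<And>z. \<not> (z \<epsilon> k \<and> z \<epsilon> l)" for k l c d
  proof -
    have "del c k \<approx> del d l" using eqpoll_del that by blast
    moreover have "del d l = sdiff S (del c k)"
      by (rule extensionality) (use that(2-4) S assms in \<open>auto\<close>)
    moreover have "del c k \<sqsubseteq> S" using that(2-4) S assms unfolding sub_in_def mem_del by (metis mem_cons)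
    ultimately show ?thesis unfolding even_in_def by auto
  qed
  have same: "even_in S" if "k \<approx> l" "a \<epsilon> k" "b \<epsilon> k"
     and S: "\<And>z. z \<epsilon> cons a (cons b S) \<longleftrightarrow> z \<epsilon> k \<or> z \<epsilon> l" "\<And>z. \<not> (z \<epsilon> k \<and> z \<epsilon> l)" for k l
  proof -
    have "cons a (del a k) \<approx> l" using that by simp
    then obtain c where c: "c \<epsilon> l" "del a k \<approx> del c l" by (rule eqpoll_cons_left) auto
    then have "cons c (del b (del a k)) \<approx> cons b (del b (del a k))"
      using that by (intro eqpoll_cons eqpoll_refl) auto
    also have "cons b (del b (del a k)) = del a k" using that assms by simp
    finally have "cons c (del b (del a k)) \<approx> del c l" using eqpoll_trans c(2) by blast
    moreover have "del c l = sdiff S (cons c (del b (del a k)))"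
    proof (rule extensionality, intro allI)
      fix z show "z \<epsilon> del c l \<longleftrightarrow> z \<epsilon> sdiff S (cons c (del b (del a k)))"
        using that(2,3) S(1)[of z] S(2)[of z] S(2)[of c] S(2)[of a] S(2)[of b] c(1) assms by auto
    qed
    moreover have "cons c (del b (del a k)) \<sqsubseteq> S"
      using that(2,3) S c(1) assms unfolding sub_in_def mem_del mem_cons by (metis mem_cons)
    ultimately show ?thesis unfolding even_in_def by auto
  qed
  have S: "\<And>z. z \<epsilon> cons a (cons b S) \<longleftrightarrow> z \<epsilon> h \<or> z \<epsilon> ?k" "\<And>z. \<not> (z \<epsilon> h \<and> z \<epsilon> ?k)"
    using h(1) by (auto simp: sub_in_def)
  have k: "?k \<approx> h" using h(2) eqpoll_sym by blast
  consider "a \<epsilon> h" "b \<epsilon> h" | "a \<epsilon> h" "b \<epsilon> ?k" | "a \<epsilon> ?k" "b \<epsilon> h" | "a \<epsilon> ?k" "b \<epsilon> ?k"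
    by auto
  then show "even_in S"
  proof cases
    case 1 then show ?thesis using same[OF h(2)] S by blast
  next
    case 2 then show ?thesis using opposite[OF h(2)] S by blast
  next
    case 3 then show ?thesis using opposite[OF h(2)] S by blast
  next
    case 4 then show ?thesis using same[OF k] S by blast
  qed
qed

lemma even_cons:
  assumes "fin S" "\<not> a \<epsilon> S" shows "even_in (cons a S) \<longleftrightarrow> \<not> even_in S"
proof -
  from assms(1) have "\<forall>a. \<not> a \<epsilon> S \<longrightarrow> (even_in (cons a S) \<longleftrightarrow> \<not> even_in S)"
  proof (induction rule: fin_induct)
    case definable show ?case by (intro dfn)
  next
    case empty then show ?case using not_even_single even_empty by blast
  next
    case (cons S b)
    then show ?case using even_cons_cons[of _ S b] by auto
  qed
  then show ?thesis using assms(2) by blast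
qed

lemma even_un:
  assumes "fin T" "fin S" "\<And>z. \<not> (z \<epsilon> S \<and> z \<epsilon> T)"
  shows "even_in (un S T) \<longleftrightarrow> (even_in S \<longleftrightarrow> even_in T)"
proof -
  from assms(1) have "(\<forall>z. \<not> (z \<epsilon> S \<and> z \<epsilon> T)) \<longrightarrow>
      (even_in (un S T) \<longleftrightarrow> (even_in S \<longleftrightarrow> even_in T))"
  proof (induction rule: fin_induct)
    case definable show ?case by (intro dfn)
  next
    case empty have "un S \<zero> = S" by (rule extensionality) auto
    then show ?case using even_empty by simp
  next
    case (cons T a)
    have eq: "un S (cons a T) = cons a (un S T)" by (rule extensionality) auto
    show ?case
    proof
      assume d: "\<forall>z. \<not> (z \<epsilon> S \<and> z \<epsilon> cons a T)"
      then have a: "\<not> a \<epsilon> un S T" and "\<forall>z. \<not> (z \<epsilon> S \<and> z \<epsilon> T)" using cons(2) by auto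
      then have "even_in (un S T) \<longleftrightarrow> (even_in S \<longleftrightarrow> even_in T)" using cons(3) by blast
      then show "even_in (un S (cons a T)) \<longleftrightarrow> (even_in S \<longleftrightarrow> even_in (cons a T))"
        unfolding eq even_cons[OF fin_un[OF cons(1) assms(2)] a] even_cons[OF cons(1,2)] by blast
    qed
  qed
  then show ?thesis using assms by blast
qed

section \<open>The Schroeder-Bernstein theorem\<close>

text \<open>
  The usual proof: \<open>C\<close> is the least class that contains the points of \<open>X\<close> outside the range of \<open>g\<close> and
  is closed under \<open>g \<circ> f\<close>; the bijection is \<open>f\<close> on \<open>C\<close> and the inverse of \<open>g\<close> elsewhere. Both injections
  are definable operations on the structure rather than sets.
\<close>

lemma schroeder_bernstein:
  assumes f: "dterm (\<lambda>e. f (e 0))" and g: "dterm (\<lambda>e. g (e 0))"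
    and fY: "\<And>x. x \<epsilon> X \<Longrightarrow> f x \<epsilon> Y" and gX: "\<And>y. y \<epsilon> Y \<Longrightarrow> g y \<epsilon> X"
    and f_inj: "\<And>x x'. x \<epsilon> X \<Longrightarrow> x' \<epsilon> X \<Longrightarrow> f x = f x' \<Longrightarrow> x = x'"
    and g_inj: "\<And>y y'. y \<epsilon> Y \<Longrightarrow> y' \<epsilon> Y \<Longrightarrow> g y = g y' \<Longrightarrow> y = y'"
  shows "X \<approx> Y"
proof -
  define closed where "closed K \<longleftrightarrow> (\<forall>x. x \<epsilon> X \<and> \<not> (\<exists>y. y \<epsilon> Y \<and> x = g y) \<longrightarrow> x \<epsilon> K) \<and>
    (\<forall>x. x \<epsilon> X \<and> x \<epsilon> K \<longrightarrow> g (f x) \<epsilon> K)" for K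
  define C where "C x \<longleftrightarrow> (\<forall>K. closed K \<longrightarrow> x \<epsilon> K)" for x
  have C_pdef: "pdef (\<lambda>e. C (s e))" if "dterm s" for s
    unfolding C_def closed_def
    by (rule pdef_app1[OF _ that]) (intro dfn dterm_app1[OF f] dterm_app1[OF g])
  have "closed X" unfolding closed_def using fY gX by blast
  then have CX: "x \<epsilon> X" if "C x" for x using that unfolding C_def by blast
  have base: "C x" if "x \<epsilon> X" "\<not> (\<exists>y. y \<epsilon> Y \<and> x = g y)" for x
    using that unfolding C_def closed_def by blast
  have step: "C (g (f x))" if "C x" for x
    using that CX[OF that] unfolding C_def closed_def by blast
  have inv: "\<not> (\<exists>y. y \<epsilon> Y \<and> x = g y) \<or> (\<exists>x'. C x' \<and> x = g (f x'))" if x: "C x" for x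
  proof -
    \<comment> \<open>The points of \<open>C\<close> that arise by one of the two clauses form a closed set, hence are all of \<open>C\<close>.\<close>
    have "small (\<lambda>x. x \<epsilon> X \<and> (C x \<and> (\<not> (\<exists>y. y \<epsilon> Y \<and> x = g y) \<or> (\<exists>x'. C x' \<and> x = g (f x')))))"
      by (rule small_comp) (intro dfn C_pdef dterm_app1[OF f] dterm_app1[OF g])
    then obtain K where K: "\<And>x. x \<epsilon> K \<longleftrightarrow>
        x \<epsilon> X \<and> (C x \<and> (\<not> (\<exists>y. y \<epsilon> Y \<and> x = g y) \<or> (\<exists>x'. C x' \<and> x = g (f x'))))"
      unfolding small_def by blast
    have "closed K" unfolding closed_def
    proof (intro conjI allI impI)
      fix x assume "x \<epsilon> X \<and> \<not> (\<exists>y. y \<epsilon> Y \<and> x = g y)"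
      then show "x \<epsilon> K" unfolding K using base by blast
    next
      fix x assume x: "x \<epsilon> X \<and> x \<epsilon> K"
      then have "C x" unfolding K by blast
      then show "g (f x) \<epsilon> K" unfolding K using step fY gX x by blast
    qed
    then have "x \<epsilon> K" using x unfolding C_def by blast
    then show ?thesis unfolding K by blast
  qed
  let ?G = "\<lambda>x y. x \<epsilon> X \<and> y \<epsilon> Y \<and> (C x \<and> y = f x \<or> \<not> C x \<and> x = g y)"
  show ?thesis
  proof (rule eqpollI)
    show "biject ?G X Y" unfolding biject_def
    proof (intro conjI allI impI)
      show "\<exists>y. ?G x y" if "x \<epsilon> X" for x using that base fY by blast
      show "\<exists>x. ?G x y" if y: "y \<epsilon> Y" for y
      proof (cases "C (g y)")
        case True
        then obtain x' where x': "C x'" "g y = g (f x')" using inv y by blast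
        then have "y = f x'" using g_inj y fY CX by blast
        then show ?thesis using x' y CX by blast
      qed (use y gX in blast)
      show "y = y'" if "?G x y \<and> ?G x y'" for x y y' using that g_inj by blast
      show "x = x'" if "?G x y \<and> ?G x' y" for x x' y using that f_inj step by blast
    qed blast+
  qed (intro dfn C_pdef dterm_app1[OF f] dterm_app1[OF g])
qed

section \<open>Comparing sizes of finite sets\<close>

text \<open>
  The size of a tag. Two extra elements, and not one, make a tag of the empty set distinguishable
  from the singleton blocks.
\<close>

abbreviation plus_two where "plus_two X \<equiv> succ_in E (succ_in E X)"

lemma succ_neq: "succ_in E X \<noteq> X"
  using mem_irrefl mem_succ by metis

lemma eqpoll_uncons:
  assumes "cons a S \<approx> cons b T" "\<not> a \<epsilon> S" "\<not> b \<epsilon> T" shows "S \<approx> T"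
  using eqpoll_del[OF assms(1), of a b] assms(2,3) by simp

lemma succ_eqpoll_iff: "succ_in E X \<approx> succ_in E Y \<longleftrightarrow> X \<approx> Y"
  unfolding succ_eq_cons using eqpoll_uncons eqpoll_cons mem_irrefl by blast

lemma plus_two_eqpoll_iff: "plus_two X \<approx> plus_two Y \<longleftrightarrow> X \<approx> Y"
  unfolding succ_eqpoll_iff ..

lemma fin_plus_two: "fin X \<Longrightarrow> fin (plus_two X)"
  unfolding succ_eq_cons by (intro fin_cons)

text \<open>
  Applying \<open>plus_two\<close> to a subset adds other elements than applying it to the whole set, so
  monotonicity holds only up to equipollence.
\<close>

lemma plus_two_mono: assumes "R \<sqsubseteq> W" shows "\<exists>R'. R' \<sqsubseteq> plus_two W \<and> plus_two R \<approx> R'"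
proof (intro exI conjI)
  have "\<not> W \<epsilon> R" using assms mem_irrefl unfolding sub_in_def by blast
  then have "cons R R \<approx> cons W R" using mem_irrefl by (intro eqpoll_cons eqpoll_refl)
  moreover have "\<not> succ_in E R \<epsilon> cons R R"
    using mem_asym[of "succ_in E R" R] succ_neq by auto
  moreover have "\<not> succ_in E W \<epsilon> cons W R"
    using mem_asym[of "succ_in E W" W] succ_neq assms unfolding sub_in_def by auto
  ultimately show "plus_two R \<approx> cons (succ_in E W) (cons W R)"
    unfolding succ_eq_cons[of "succ_in E R"] by (intro eqpoll_cons) (simp_all add: succ_eq_cons)
  show "cons (succ_in E W) (cons W R) \<sqsubseteq> plus_two W" using assms by (auto simp: sub_in_def)
qed

lemma fresh_copy:
  assumes A: "\<not> fin A" and U: "fin U" and "fin K"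
  shows "\<exists>V. V \<sqsubseteq> A \<and> V \<approx> K \<and> (\<forall>x. x \<epsilon> V \<longrightarrow> \<not> x \<epsilon> U)"
  using assms(3)
proof (induction rule: fin_induct)
  case definable show ?case by (intro dfn)
next
  case empty show ?case by (rule exI[of _ \<zero>]) (auto simp: sub_in_def eqpoll_refl)
next
  case (cons K b)
  then obtain V where V: "V \<sqsubseteq> A" "V \<approx> K" "\<forall>x. x \<epsilon> V \<longrightarrow> \<not> x \<epsilon> U" by blast
  have "fin V" using V(2) cons(1) fin_eqpoll eqpoll_sym by blast
  then have "fin (un V U)" using U fin_un by blast
  then obtain a where a: "a \<epsilon> A" "\<not> a \<epsilon> un V U" using fin_nonsub[OF A] by blast
  have "cons a V \<approx> cons b K" using eqpoll_cons V(2) a(2) cons(2) by simp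
  then show ?case using V a by (intro exI[of _ "cons a V"]) (auto simp: sub_in_def)
qed

text \<open>
  Strictly more than \<open>|W| + 2\<close> elements, for finite \<open>B\<close>. This is the growth condition on fibres: by
  \<open>big_not_eqpoll\<close> no finite set that includes \<open>B\<close> has the size of a part of \<open>W\<close> or of a tag for a part of \<open>W\<close>.
\<close>

definition big :: "'v \<Rightarrow> 'v \<Rightarrow> bool" where
  "big W B \<longleftrightarrow> (\<exists>V. V \<sqsubseteq> B \<and> V \<noteq> B \<and> V \<approx> plus_two W)"

lemma big_not_eqpoll:
  assumes "big W B" "B \<sqsubseteq> Q" "fin Q" "Q \<approx> R" "R \<sqsubseteq> plus_two W" "fin W"
  shows False
proof -
  obtain V where V: "V \<sqsubseteq> B" "V \<noteq> B" "V \<approx> plus_two W" using assms(1) unfolding big_def by blast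
  obtain R' where R': "R' \<sqsubseteq> V" "R \<approx> R'"
    using eqpoll_subset[OF fin_plus_two[OF assms(6)] eqpoll_sym[OF V(3)] assms(5)] by blast
  have "Q \<approx> R'" using assms(4) R'(2) eqpoll_trans by blast
  moreover have "R' \<sqsubseteq> Q" using R'(1) V(1) assms(2) unfolding sub_in_def by blast
  ultimately have "R' = Q" using pigeonhole assms(3) by blast
  then have "V = B" using R'(1) V(1) assms(2) unfolding sub_in_def by (intro extensionality) blast
  then show False using V(2) by blast
qed

lemma big_not_singleton: assumes "big W B" shows "\<not> singleton_in E B"
proof
  assume "singleton_in E B"
  then obtain b where b: "\<forall>z. z \<epsilon> B \<longleftrightarrow> z = b" unfolding singleton_in_def by blast
  obtain V where V: "V \<sqsubseteq> B" "V \<noteq> B" "V \<approx> plus_two W" using assms unfolding big_def by blast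
  then have "V = \<zero>" using b unfolding sub_in_def ext_iff[of V B] ext_iff[of V \<zero>] by auto
  then have "plus_two W = \<zero>" using V(3) eqpoll_sym eqpoll_empty by blast
  then show False using mem_succ[of "succ_in E W" "succ_in E W"] by simp
qed

section \<open>Fibred finite sets\<close>

text \<open>
  A blurring is a set \<open>p\<close> of pairs; \<open>rel p x d\<close> says that \<open>x\<close> lies in the fibre of \<open>d\<close>.
\<close>

abbreviation rel where "rel p x d \<equiv> pair_in E x d \<epsilon> p"

definition preim :: "'v \<Rightarrow> 'v \<Rightarrow> 'v" where
  "preim p X = coll E (\<lambda>x. \<exists>d. d \<epsilon> X \<and> rel p x d)"

lemma mem_preim [simp]: "x \<epsilon> preim p X \<longleftrightarrow> (\<exists>d. d \<epsilon> X \<and> rel p x d)"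
  unfolding preim_def
proof (rule mem_coll_small, rule small_sub[OF _ small_mem[of "union_of (union_of p)"]])
  fix x assume "\<exists>d. d \<epsilon> X \<and> rel p x d"
  then obtain d where "rel p x d" by blast
  moreover have "x \<epsilon> upair_in E x x" "upair_in E x x \<epsilon> pair_in E x d" by (simp_all add: pair_in_def)
  ultimately show "x \<epsilon> union_of (union_of p)" unfolding mem_union_of by blast
qed (intro dfn)

lemma dterm_preim [dfn]: "dterm s \<Longrightarrow> dterm t \<Longrightarrow> dterm (\<lambda>e. preim (s e) (t e))"
  by (rule dterm_app2[where f = preim]) (rule dterm_coll, rule mem_preim, intro dfn)

abbreviation fib where "fib p d \<equiv> preim p (cons d \<zero>)"

text \<open>The blurring \<open>p\<close> with the fibre of \<open>y\<close> replaced by \<open>B\<close>.\<close>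

definition refibre :: "'v \<Rightarrow> 'v \<Rightarrow> 'v \<Rightarrow> 'v" where
  "refibre p y B = coll E (\<lambda>q. q \<epsilon> p \<and> \<not> (\<exists>x. q = pair_in E x y) \<or> (\<exists>x. x \<epsilon> B \<and> q = pair_in E x y))"

lemma mem_refibre: "q \<epsilon> refibre p y B \<longleftrightarrow>
    q \<epsilon> p \<and> \<not> (\<exists>x. q = pair_in E x y) \<or> (\<exists>x. x \<epsilon> B \<and> q = pair_in E x y)"
  unfolding refibre_def
  by (rule mem_coll_small, rule small_un, rule small_comp, intro dfn, rule small_image, intro dfn)

lemma rel_refibre [simp]: "rel (refibre p y B) x d \<longleftrightarrow> rel p x d \<and> d \<noteq> y \<or> x \<epsilon> B \<and> d = y"
  unfolding mem_refibre by auto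

lemma dterm_refibre: "dterm s \<Longrightarrow> dterm (\<lambda>e. refibre p y (s e))"
  by (rule dterm_app1[where f = "refibre p y"]) (rule dterm_coll, rule mem_refibre, intro dfn)

definition isimg :: "'v \<Rightarrow> 'v \<Rightarrow> 'v \<Rightarrow> bool" where
  "isimg p S S' \<longleftrightarrow> (\<forall>d. d \<epsilon> S' \<longleftrightarrow> (\<exists>x. x \<epsilon> S \<and> rel p x d))"

text \<open>
  \<open>F\<close> is a copy of \<open>F'\<close> if \<open>p\<close> maps the union of \<open>F\<close> injectively to that of \<open>F'\<close> and carries
  the members of \<open>F\<close> exactly to the members of \<open>F'\<close>; equivalently, \<open>F\<close> arises from \<open>F'\<close> by choosing a
  point in each fibre. The last two clauses make the map surjective.
\<close>

definition copy :: "'v \<Rightarrow> 'v \<Rightarrow> 'v \<Rightarrow> bool" where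
  "copy p F' F \<longleftrightarrow> (\<forall>x. x \<epsilon> union_of F \<longrightarrow> (\<exists>d. rel p x d)) \<and>
     (\<forall>x x' d. x \<epsilon> union_of F \<and> x' \<epsilon> union_of F \<and> rel p x d \<and> rel p x' d \<longrightarrow> x = x') \<and>
     (\<forall>S. S \<epsilon> F \<longrightarrow> (\<exists>S'. S' \<epsilon> F' \<and> isimg p S S')) \<and>
     (\<forall>S'. S' \<epsilon> F' \<longrightarrow> (\<exists>S. S \<epsilon> F \<and> isimg p S S'))"

lemma copy_cong:
  assumes "\<And>x d. x \<epsilon> union_of F \<Longrightarrow> rel p x d \<longleftrightarrow> rel q x d"
  shows "copy p F' F \<longleftrightarrow> copy q F' F"
proof -
  have "isimg p S S' \<longleftrightarrow> isimg q S S'" if "S \<epsilon> F" for S S'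
  proof -
    have "x \<epsilon> S \<and> rel p x d \<longleftrightarrow> x \<epsilon> S \<and> rel q x d" for x d using assms[of x d] that by auto
    then show ?thesis unfolding isimg_def by simp
  qed
  then have
    "(\<forall>S. S \<epsilon> F \<longrightarrow> (\<exists>S'. S' \<epsilon> F' \<and> isimg p S S')) \<longleftrightarrow> (\<forall>S. S \<epsilon> F \<longrightarrow> (\<exists>S'. S' \<epsilon> F' \<and> isimg q S S'))"
    "(\<forall>S'. S' \<epsilon> F' \<longrightarrow> (\<exists>S. S \<epsilon> F \<and> isimg p S S')) \<longleftrightarrow> (\<forall>S'. S' \<epsilon> F' \<longrightarrow> (\<exists>S. S \<epsilon> F \<and> isimg q S S'))"
    by blast+
  moreover have
    "(\<forall>x. x \<epsilon> union_of F \<longrightarrow> (\<exists>d. rel p x d)) \<longleftrightarrow> (\<forall>x. x \<epsilon> union_of F \<longrightarrow> (\<exists>d. rel q x d))"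
    "(\<forall>x x' d. x \<epsilon> union_of F \<and> x' \<epsilon> union_of F \<and> rel p x d \<and> rel p x' d \<longrightarrow> x = x') \<longleftrightarrow>
     (\<forall>x x' d. x \<epsilon> union_of F \<and> x' \<epsilon> union_of F \<and> rel q x d \<and> rel q x' d \<longrightarrow> x = x')"
    using assms by blast+
  ultimately show ?thesis unfolding copy_def by simp
qed

definition copies :: "'v \<Rightarrow> 'v \<Rightarrow> 'v \<Rightarrow> 'v" where
  "copies F' Y p = coll E (\<lambda>F. F \<epsilon> Y \<and> copy p F' F)"

lemma mem_copies [simp]: "F \<epsilon> copies F' Y p \<longleftrightarrow> F \<epsilon> Y \<and> copy p F' F"
  unfolding copies_def
  by (rule mem_coll_small, rule small_comp) (unfold copy_def isimg_def, intro dfn)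

lemma dterm_copies [dfn]: "dterm s \<Longrightarrow> dterm (\<lambda>e. copies F' Y (s e))"
  by (rule dterm_app1[where f = "copies F' Y"])
    (rule dterm_coll, rule mem_copies, unfold copy_def isimg_def, intro dfn)

text \<open>
  A blurring over \<open>D\<close> in which the points of \<open>S\<close> are not blurred, and the remaining fibres are
  large and spread enough for a partition to be decoded: the total size of the fibres over a set of
  blurred points determines the set, and no fibre has the size of a tag. The points of \<open>S\<close> are left
  out of these two conditions, which speak of the part already blurred.
\<close>

definition admissible :: "'v \<Rightarrow> 'v \<Rightarrow> 'v \<Rightarrow> 'v \<Rightarrow> bool" where
  "admissible A D p S \<longleftrightarrow>
     (\<forall>x d. rel p x d \<longrightarrow> x \<epsilon> A \<and> d \<epsilon> D) \<and>
     (\<forall>x d d'. rel p x d \<and> rel p x d' \<longrightarrow> d = d') \<and>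
     fin (preim p D) \<and>
     (\<forall>d. d \<epsilon> S \<longrightarrow> singleton_in E (fib p d)) \<and>
     (\<forall>d. d \<epsilon> D \<and> \<not> d \<epsilon> S \<longrightarrow> \<not> singleton_in E (fib p d)) \<and>
     (\<forall>X X'. X \<sqsubseteq> sdiff D S \<and> X' \<sqsubseteq> sdiff D S \<and> preim p X \<approx> preim p X' \<longrightarrow> X = X') \<and>
     (\<forall>X d. X \<sqsubseteq> sdiff D S \<and> d \<epsilon> sdiff D S \<longrightarrow> \<not> fib p d \<approx> plus_two (preim p X))"

lemma fin_copies:
  assumes "fin U" "\<And>x d. rel p x d \<Longrightarrow> x \<epsilon> U" shows "fin (copies F' Y p)"
proof (rule fin_sub[OF fin_Pow[OF fin_Pow[OF assms(1)]]])
  have "F \<epsilon> Pow_in E (Pow_in E U)" if "copy p F' F" for F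
    using that assms(2) unfolding copy_def mem_Pow sub_in_def mem_union_of by blast
  then show "copies F' Y p \<sqsubseteq> Pow_in E (Pow_in E U)" unfolding sub_in_def[of E "copies F' Y p"] by simp
qed

lemma copy_hits_fibre:
  assumes "copy p F' F" "d \<epsilon> union_of F'" obtains x where "x \<epsilon> union_of F" "rel p x d"
proof -
  obtain S' where "S' \<epsilon> F'" "d \<epsilon> S'" using assms(2) by auto
  then obtain S where "S \<epsilon> F" "isimg p S S'" using assms(1) unfolding copy_def by blast
  then show ?thesis using that \<open>d \<epsilon> S'\<close> unfolding isimg_def mem_union_of by blast
qed

text \<open>
  Additivity in the fibre over \<open>y\<close>. Every copy uses exactly one point of that fibre, so the copies for
  the fibre \<open>B \<union> {z}\<close> are those for \<open>B\<close> together with those for \<open>{z}\<close>, and no copy is counted twice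
  because the points of the fibre belong to no other fibre.
\<close>

lemma even_copies_cons:
  assumes y: "y \<epsilon> union_of F'" and p: "fin (preim p (union_of F'))" "\<And>x d. rel p x d \<Longrightarrow> d \<epsilon> union_of F'"
    and B: "fin B" "\<And>x d. x \<epsilon> B \<Longrightarrow> rel p x d \<Longrightarrow> d = y"
    and z: "\<not> z \<epsilon> B" "\<And>d. rel p z d \<Longrightarrow> d = y"
  shows "even_in (copies F' Y (refibre p y (cons z B))) \<longleftrightarrow>
    (even_in (copies F' Y (refibre p y B)) \<longleftrightarrow> even_in (copies F' Y (refibre p y (cons z \<zero>))))"
proof -
  let ?q = "refibre p y"
  have fin: "fin (copies F' Y (?q C))" if "fin C" for C
  proof (rule fin_copies)
    show "fin (un (preim p (union_of F')) C)" using fin_un that p(1) by blast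
    show "x \<epsilon> un (preim p (union_of F')) C" if "rel (?q C) x d" for x d
      using that p(2)[of x d] unfolding mem_un mem_preim rel_refibre by blast
  qed
  have avoid: "\<not> x \<epsilon> union_of F" if "copy (?q C) F' F" "\<And>d. rel p x d \<Longrightarrow> d = y" "\<not> x \<epsilon> C" for C x F
    using that unfolding copy_def rel_refibre by blast
  have 1: "copy (?q (cons z B)) F' F \<longleftrightarrow> copy (?q B) F' F" if "\<not> z \<epsilon> union_of F" for F
    by (rule copy_cong) (use that in auto)
  have 2: "copy (?q (cons z B)) F' F \<longleftrightarrow> copy (?q (cons z \<zero>)) F' F" if "\<And>x. x \<epsilon> B \<Longrightarrow> \<not> x \<epsilon> union_of F" for F
    by (rule copy_cong) (use that in auto)
  have zB: "\<not> z \<epsilon> union_of F" if "copy (?q B) F' F" for F using avoid[OF that] z by blast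
  have Bz: "\<not> x \<epsilon> union_of F" if "copy (?q (cons z \<zero>)) F' F" "x \<epsilon> B" for F x
    using avoid[OF that(1), of x] B that(2) z(1) by auto
  have hit: "\<exists>x. x \<epsilon> union_of F \<and> x \<epsilon> C" if "copy (?q C) F' F" for F C
    using copy_hits_fibre[OF that y] unfolding rel_refibre by blast
  have either: "copy (?q B) F' F \<or> copy (?q (cons z \<zero>)) F' F" if c: "copy (?q (cons z B)) F' F" for F
  proof (cases "z \<epsilon> union_of F")
    case True
    have "\<not> x \<epsilon> union_of F" if "x \<epsilon> B" for x
    proof
      assume x: "x \<epsilon> union_of F"
      have "rel (?q (cons z B)) x y" "rel (?q (cons z B)) z y" using that by simp_all
      then have "x = z" using c x True unfolding copy_def by blast
      then show False using that z(1) by blast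
    qed
    then show ?thesis using 2 c by blast
  next
    case False then show ?thesis using 1 c by blast
  qed
  have "copies F' Y (?q (cons z B)) = un (copies F' Y (?q B)) (copies F' Y (?q (cons z \<zero>)))"
  proof (rule extensionality, intro allI)
    fix F
    have "copy (?q (cons z B)) F' F \<longleftrightarrow> copy (?q B) F' F \<or> copy (?q (cons z \<zero>)) F' F"
      using either 1 2 zB Bz by blast
    then show "F \<epsilon> copies F' Y (?q (cons z B)) \<longleftrightarrow>
        F \<epsilon> un (copies F' Y (?q B)) (copies F' Y (?q (cons z \<zero>)))" by auto
  qed
  moreover have "\<not> (F \<epsilon> copies F' Y (?q B) \<and> F \<epsilon> copies F' Y (?q (cons z \<zero>)))" for F
  proof
    assume "F \<epsilon> copies F' Y (?q B) \<and> F \<epsilon> copies F' Y (?q (cons z \<zero>))"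
    then have "copy (?q B) F' F" "copy (?q (cons z \<zero>)) F' F" by simp_all
    then show False using hit Bz by blast
  qed
  ultimately show ?thesis using even_un[OF fin[OF fin_cons[OF fin_empty]] fin[OF B(1)]] by simp
qed

text \<open>
  A single point may be blurred by any fresh fibre \<open>B\<close> that is big compared with all other
  fibres together. Comparing two sets of blurred points, if only one contains \<open>y\<close> then its fibres
  outweigh the others; if both do, \<open>B\<close> can be cancelled. The comparison of fibres with tags is similar.
\<close>

lemma admissible_refibre:
  assumes p: "admissible A D p (cons y S)" and y: "y \<epsilon> D" "\<not> y \<epsilon> S"
    and B: "B \<sqsubseteq> A" "fin B" "\<And>x. x \<epsilon> B \<Longrightarrow> \<not> x \<epsilon> preim p (del y D)"
    and big: "big (preim p (del y D)) B"
  shows "admissible A D (refibre p y B) S"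
proof -
  let ?W = "preim p (del y D)" and ?q = "refibre p y B"
  have p1: "\<And>x d. rel p x d \<Longrightarrow> x \<epsilon> A \<and> d \<epsilon> D"
    and p2: "\<And>x d d'. rel p x d \<Longrightarrow> rel p x d' \<Longrightarrow> d = d'"
    and p3: "fin (preim p D)"
    and p4: "\<And>d. d \<epsilon> S \<Longrightarrow> singleton_in E (fib p d)"
    and p5: "\<And>d. d \<epsilon> D \<Longrightarrow> d \<noteq> y \<Longrightarrow> \<not> d \<epsilon> S \<Longrightarrow> \<not> singleton_in E (fib p d)"
    and p6: "\<And>X X'. X \<sqsubseteq> sdiff D (cons y S) \<Longrightarrow> X' \<sqsubseteq> sdiff D (cons y S) \<Longrightarrow>
        preim p X \<approx> preim p X' \<Longrightarrow> X = X'"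
    and p7: "\<And>X d. X \<sqsubseteq> sdiff D (cons y S) \<Longrightarrow> d \<epsilon> sdiff D (cons y S) \<Longrightarrow>
        \<not> fib p d \<approx> plus_two (preim p X)"
    using p unfolding admissible_def by auto
  have finW: "fin ?W" by (rule fin_sub[OF p3]) (auto simp: sub_in_def)
  have pre_in: "preim ?q X = un (preim p (del y X)) B" if "y \<epsilon> X" for X
    by (rule extensionality) (use that in auto)
  have pre_out: "preim ?q X = preim p X" if "\<not> y \<epsilon> X" for X
    by (rule extensionality) (use that in auto)
  have fib_y: "fib ?q y = B" by (rule extensionality) auto
  have fib_other: "fib ?q d = fib p d" if "d \<noteq> y" for d by (rule pre_out) (use that in auto)
  have W_sub: "preim p X \<sqsubseteq> ?W" if "X \<sqsubseteq> sdiff D S" "\<not> y \<epsilon> X" for X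
    using that unfolding sub_in_def mem_preim mem_del mem_sdiff by blast
  have W_plus_two: "R \<sqsubseteq> plus_two ?W" if "R \<sqsubseteq> ?W" for R using that unfolding sub_in_def mem_succ by blast
  have finpre: "fin (preim ?q X)" if "X \<sqsubseteq> sdiff D S" for X
  proof (rule fin_sub)
    show "fin (un (preim p D) B)" using fin_un p3 B(2) by blast
    show "preim ?q X \<sqsubseteq> un (preim p D) B" using that unfolding sub_in_def by auto
  qed
  have B_sub: "B \<sqsubseteq> preim ?q X" if "y \<epsilon> X" for X
    unfolding pre_in[OF that] by (simp add: sub_in_def)
  have mixed: "\<not> preim ?q X \<approx> preim ?q X'"
    if "X \<sqsubseteq> sdiff D S" "X' \<sqsubseteq> sdiff D S" "y \<epsilon> X" "\<not> y \<epsilon> X'" for X X'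
  proof
    assume "preim ?q X \<approx> preim ?q X'"
    then have "preim ?q X \<approx> preim p X'" using pre_out that(4) by simp
    then show False
      using big_not_eqpoll[OF big B_sub[OF that(3)] finpre[OF that(1)] _ W_plus_two[OF W_sub[OF that(2,4)]] finW]
      by blast
  qed
  have sub': "X \<sqsubseteq> sdiff D (cons y S)" if "X \<sqsubseteq> sdiff D S" "\<not> y \<epsilon> X" for X
    using that unfolding sub_in_def mem_sdiff mem_cons by blast
  have q6: "X = X'"
    if X: "X \<sqsubseteq> sdiff D S" and X': "X' \<sqsubseteq> sdiff D S" and eq: "preim ?q X \<approx> preim ?q X'" for X X'
  proof (cases "y \<epsilon> X"; cases "y \<epsilon> X'")
    assume yX: "y \<epsilon> X" and yX': "y \<epsilon> X'"
    have dX: "del y X \<sqsubseteq> sdiff D S" "del y X' \<sqsubseteq> sdiff D S"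
      using X X' unfolding sub_in_def by auto
    have "preim p (del y X) \<approx> preim p (del y X')"
    proof (rule eqpoll_cancel[OF B(2)])
      show "un (preim p (del y X)) B \<approx> un (preim p (del y X')) B"
        using eq unfolding pre_in[OF yX] pre_in[OF yX'] .
      show "\<not> z \<epsilon> preim p (del y X) \<and> \<not> z \<epsilon> preim p (del y X')" if "z \<epsilon> B" for z
        using B(3)[OF that] W_sub[OF dX(1)] W_sub[OF dX(2)] unfolding sub_in_def by auto
    qed
    then have "del y X = del y X'"
      using p6 sub'[OF dX(1)] sub'[OF dX(2)] by simp
    then show "X = X'" using cons_del[OF yX] cons_del[OF yX'] by metis
  next
    assume "y \<epsilon> X" "\<not> y \<epsilon> X'" then show ?thesis using mixed X X' eq by blast
  next
    assume "\<not> y \<epsilon> X" "y \<epsilon> X'" then show ?thesis using mixed X X' eq eqpoll_sym by blast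
  next
    assume "\<not> y \<epsilon> X" "\<not> y \<epsilon> X'" then show ?thesis using p6 sub' X X' eq pre_out by simp
  qed
  have q7: "\<not> fib ?q d \<approx> plus_two (preim ?q X)" if X: "X \<sqsubseteq> sdiff D S" and d: "d \<epsilon> sdiff D S" for X d
  proof
    assume eq: "fib ?q d \<approx> plus_two (preim ?q X)"
    show False
    proof (cases "y \<epsilon> X"; cases "d = y")
      assume yX: "y \<epsilon> X" and "d = y"
      let ?Q = "preim ?q X"
      have "plus_two ?Q \<approx> B" using eq \<open>d = y\<close> fib_y eqpoll_sym by simp
      moreover have "B \<sqsubseteq> plus_two ?Q" using B_sub[OF yX] unfolding sub_in_def mem_succ by blast
      ultimately have "B = plus_two ?Q" using pigeonhole fin_plus_two[OF finpre[OF X]] by blast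
      then have "?Q \<epsilon> B" unfolding ext_iff[of B] mem_succ by blast
      then have "?Q \<epsilon> ?Q" using B_sub[OF yX] unfolding sub_in_def by blast
      then show False using mem_irrefl by blast
    next
      assume yX: "y \<epsilon> X" and "d \<noteq> y"
      have "cons d \<zero> \<sqsubseteq> sdiff D S" "\<not> y \<epsilon> cons d \<zero>" using d \<open>d \<noteq> y\<close> by (auto simp: sub_in_def)
      then have "fib p d \<sqsubseteq> plus_two ?W" using W_plus_two W_sub by blast
      moreover have "plus_two (preim ?q X) \<approx> fib p d" using eq eqpoll_sym fib_other[OF \<open>d \<noteq> y\<close>] by simp
      moreover have "B \<sqsubseteq> plus_two (preim ?q X)" using B_sub[OF yX] unfolding sub_in_def mem_succ by blast
      ultimately show False using big_not_eqpoll[OF big _ fin_plus_two[OF finpre[OF X]] _ _ finW] by blast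
    next
      assume yX: "\<not> y \<epsilon> X" and "d = y"
      obtain R where R: "R \<sqsubseteq> plus_two ?W" "plus_two (preim p X) \<approx> R" using plus_two_mono W_sub[OF X yX] by blast
      have "B \<approx> plus_two (preim p X)" using eq fib_y pre_out[OF yX] \<open>d = y\<close> by simp
      then have "B \<approx> R" using R(2) eqpoll_trans by blast
      moreover have "B \<sqsubseteq> B" by (simp add: sub_in_def)
      ultimately show False using big_not_eqpoll[OF big _ B(2) _ R(1) finW] by blast
    next
      assume yX: "\<not> y \<epsilon> X" and "d \<noteq> y"
      then show False using p7[OF sub'[OF X yX], of d] d eq fib_other pre_out[OF yX] by auto
    qed
  qed
  show ?thesis unfolding admissible_def
  proof (intro conjI allI impI)
    show "x \<epsilon> A" if "rel ?q x d" for x d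
      using that p1 B(1) unfolding rel_refibre sub_in_def by blast
    show "d \<epsilon> D" if "rel ?q x d" for x d using that p1 y unfolding rel_refibre by blast
    show "d = d'" if "rel ?q x d \<and> rel ?q x d'" for x d d'
      using that p1 p2 B(3)[of x] unfolding rel_refibre mem_preim mem_del by blast
    show "fin (preim ?q D)" unfolding pre_in[OF y(1)] using fin_un finW B(2) by blast
    show "singleton_in E (fib ?q d)" if "d \<epsilon> S" for d
      using p4[OF that] fib_other[of d] y(2) that by metis
    show "\<not> singleton_in E (fib ?q d)" if "d \<epsilon> D \<and> \<not> d \<epsilon> S" for d
      using p5[of d] fib_other[of d] fib_y big_not_singleton[OF big] that by (cases "d = y") simp_all
    show "X = X'" if "X \<sqsubseteq> sdiff D S \<and> X' \<sqsubseteq> sdiff D S \<and> preim ?q X \<approx> preim ?q X'" for X X'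
      using q6 that by blast
    show "\<not> fib ?q d \<approx> plus_two (preim ?q X)" if "X \<sqsubseteq> sdiff D S \<and> d \<epsilon> sdiff D S" for X d
      using q7 that by blast
  qed
qed

text \<open>
  The key step. Fix all fibres but that of \<open>y\<close>, and let \<open>N B\<close> be the set of the copies in \<open>Y\<close> if the fibre of
  \<open>y\<close> is \<open>B\<close>. For big \<open>B\<close> the parity of \<open>N B\<close> is even by assumption. Adding a point \<open>z\<close> or \<open>z'\<close> to
  a fresh set \<open>V\<close> that is just too small to be big thus gives even parity both times, so by additivity \<open>N {z}\<close> and \<open>N {z'}\<close> both have
  the parity of \<open>N V\<close>. Hence all singletons give the same parity \<open>h\<close>, and \<open>N B\<close> has the parity of \<open>h\<close>
  times the size of \<open>B\<close>. A big \<open>B\<close> of odd size forces \<open>h\<close> to be even.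
\<close>

lemma even_copies_step:
  assumes A: "\<not> fin A" and IH: "\<And>q. admissible A (union_of F') q S \<Longrightarrow> even_in (copies F' Y q)"
    and p: "admissible A (union_of F') p (cons y S)" and y: "y \<epsilon> union_of F'" "\<not> y \<epsilon> S"
  shows "even_in (copies F' Y p)"
proof -
  let ?D = "union_of F'" let ?W = "preim p (del y ?D)"
  define N where "N B = copies F' Y (refibre p y B)" for B
  have p1: "\<And>x d. rel p x d \<Longrightarrow> x \<epsilon> A \<and> d \<epsilon> ?D"
    and p2: "\<And>x d d'. rel p x d \<Longrightarrow> rel p x d' \<Longrightarrow> d = d'"
    and p3: "fin (preim p ?D)"
    and p4: "singleton_in E (fib p y)"
    using p unfolding admissible_def by auto
  have finW: "fin ?W" by (rule fin_sub[OF p3]) (auto simp: sub_in_def)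
  have outW: "d = y" if "\<not> x \<epsilon> ?W" "rel p x d" for x d
    using that p1[of x d] unfolding mem_preim mem_del by blast
  have N_cons: "even_in (N (cons z B)) \<longleftrightarrow> (even_in (N B) \<longleftrightarrow> even_in (N (cons z \<zero>)))"
    if "fin B" "\<And>x. x \<epsilon> B \<Longrightarrow> \<not> x \<epsilon> ?W" "\<not> z \<epsilon> B" "\<not> z \<epsilon> ?W" for B z
    unfolding N_def by (rule even_copies_cons[OF y(1) p3]) (use p1 outW that in blast)+
  have N_big: "even_in (N B)"
    if "B \<sqsubseteq> A" "fin B" "\<And>x. x \<epsilon> B \<Longrightarrow> \<not> x \<epsilon> ?W" "big ?W B" for B
    unfolding N_def using IH admissible_refibre[OF p y that(1,2) _ that(4)] that(3) by blast
  have fresh: "\<exists>V. V \<sqsubseteq> A \<and> fin V \<and> V \<approx> plus_two ?W \<and> (\<forall>x. x \<epsilon> V \<longrightarrow> \<not> x \<epsilon> ?W \<and> \<not> x \<epsilon> U)" if U: "fin U" for U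
  proof -
    obtain V where V: "V \<sqsubseteq> A" "V \<approx> plus_two ?W" "\<forall>x. x \<epsilon> V \<longrightarrow> \<not> x \<epsilon> un ?W U"
      using fresh_copy[OF A fin_un[OF U finW] fin_plus_two[OF finW]] by blast
    moreover have "fin V" using V(2) fin_eqpoll[OF fin_plus_two[OF finW]] eqpoll_sym by blast
    ultimately show ?thesis by auto
  qed
  have big1: "big ?W B" if "V \<approx> plus_two ?W" "V \<sqsubseteq> B" "b \<epsilon> B" "\<not> b \<epsilon> V" for V B b
    unfolding big_def using that by blast
  have N_const: "even_in (N (cons z \<zero>)) \<longleftrightarrow> even_in (N (cons z' \<zero>))"
    if z: "z \<epsilon> A" "\<not> z \<epsilon> ?W" "z' \<epsilon> A" "\<not> z' \<epsilon> ?W" for z z'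
  proof -
    obtain V where V: "V \<sqsubseteq> A" "fin V" "V \<approx> plus_two ?W"
      "\<And>x. x \<epsilon> V \<Longrightarrow> \<not> x \<epsilon> ?W \<and> \<not> x \<epsilon> cons z (cons z' \<zero>)"
      using fresh[OF fin_cons[OF fin_cons[OF fin_empty]], of z z'] by blast
    have "even_in (N V) \<longleftrightarrow> even_in (N (cons w \<zero>))" if "w = z \<or> w = z'" for w
    proof -
      have w: "w \<epsilon> A" "\<not> w \<epsilon> ?W" using that z by blast+
      have wV: "\<not> w \<epsilon> V" using V(4)[of w] that unfolding mem_cons by blast
      have "even_in (N (cons w V))"
      proof (rule N_big)
        show "cons w V \<sqsubseteq> A" using V(1) w(1) unfolding sub_in_def mem_cons by blast
        show "big ?W (cons w V)"
          by (rule big1[OF V(3) _ _ wV]) (simp_all add: sub_in_def)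
        show "\<not> x \<epsilon> ?W" if "x \<epsilon> cons w V" for x using that V(4) w(2) unfolding mem_cons by blast
      qed (use V(2) fin_cons in blast)
      then show ?thesis using N_cons[OF V(2) _ wV w(2)] V(4) by blast
    qed
    then show ?thesis by blast
  qed
  obtain z where z: "\<And>x. rel p x y \<longleftrightarrow> x = z" using p4 unfolding singleton_in_def by auto
  then have "rel p z y" by blast
  then have zA: "z \<epsilon> A" and zW: "\<not> z \<epsilon> ?W" using p1 p2 by (blast, auto)
  have pN: "copies F' Y p = N (cons z \<zero>)"
  proof (rule extensionality, intro allI)
    fix F
    have "copy p F' F \<longleftrightarrow> copy (refibre p y (cons z \<zero>)) F' F"
      by (rule copy_cong) (use z in auto)
    then show "F \<epsilon> copies F' Y p \<longleftrightarrow> F \<epsilon> N (cons z \<zero>)" by (simp add: N_def)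
  qed
  have formula: "even_in (N B) \<longleftrightarrow> even_in B \<or> even_in (copies F' Y p)"
    if "fin B" "B \<sqsubseteq> A" "\<And>x. x \<epsilon> B \<Longrightarrow> \<not> x \<epsilon> ?W" for B
  proof -
    from that(1) have "B \<sqsubseteq> A \<and> (\<forall>x. x \<epsilon> B \<longrightarrow> \<not> x \<epsilon> ?W) \<longrightarrow>
        (even_in (N B) \<longleftrightarrow> even_in B \<or> even_in (copies F' Y p))"
    proof (induction rule: fin_induct)
      case definable show ?case unfolding N_def by (intro dfn dterm_refibre)
    next
      case empty
      have "N \<zero> = \<zero>"
      proof (rule extensionality, intro allI)
        fix F
        have "\<not> copy (refibre p y \<zero>) F' F" using copy_hits_fibre[OF _ y(1), of "refibre p y \<zero>" F] by auto
        then show "F \<epsilon> N \<zero> \<longleftrightarrow> F \<epsilon> \<zero>" by (simp add: N_def)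
      qed
      then show ?case using even_empty by simp
    next
      case (cons B b)
      show ?case
      proof (intro impI, elim conjE)
        assume sub: "cons b B \<sqsubseteq> A" and W: "\<forall>x. x \<epsilon> cons b B \<longrightarrow> \<not> x \<epsilon> ?W"
        have b: "b \<epsilon> A" "\<not> b \<epsilon> ?W" using sub W unfolding sub_in_def mem_cons by blast+
        have "B \<sqsubseteq> A \<and> (\<forall>x. x \<epsilon> B \<longrightarrow> \<not> x \<epsilon> ?W)"
          using sub W unfolding sub_in_def mem_cons by blast
        then have "even_in (N B) \<longleftrightarrow> even_in B \<or> even_in (copies F' Y p)" using cons(3) by blast
        moreover have "even_in (N (cons b \<zero>)) \<longleftrightarrow> even_in (copies F' Y p)"
          unfolding pN using N_const zA zW b by blast
        moreover have "even_in (N (cons b B)) \<longleftrightarrow> (even_in (N B) \<longleftrightarrow> even_in (N (cons b \<zero>)))"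
          by (rule N_cons[OF cons(1) _ cons(2) b(2)]) (use W in auto)
        moreover have "even_in (cons b B) \<longleftrightarrow> \<not> even_in B" using even_cons cons(1,2) by blast
        ultimately show "even_in (N (cons b B)) \<longleftrightarrow> even_in (cons b B) \<or> even_in (copies F' Y p)"
          by blast
      qed
    qed
    then show ?thesis using that by blast
  qed
  \<comment> \<open>One of \<open>V \<union> {c}\<close> and \<open>V \<union> {c, c'}\<close> has odd size, and both are big.\<close>
  obtain V where V: "V \<sqsubseteq> A" "fin V" "V \<approx> plus_two ?W" "\<And>x. x \<epsilon> V \<Longrightarrow> \<not> x \<epsilon> ?W"
    using fresh[OF fin_empty] by blast
  obtain c where c: "c \<epsilon> A" "\<not> c \<epsilon> un V ?W" using fin_nonsub[OF A fin_un[OF finW V(2)]] by blast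
  obtain c' where c': "c' \<epsilon> A" "\<not> c' \<epsilon> un (cons c V) ?W"
    using fin_nonsub[OF A fin_un[OF finW fin_cons[OF V(2)]]] by blast
  have odd: "even_in (copies F' Y p)" if B: "B \<sqsubseteq> A" "fin B" "\<not> even_in B" "V \<sqsubseteq> B" "c \<epsilon> B"
      "\<And>x. x \<epsilon> B \<Longrightarrow> \<not> x \<epsilon> ?W" for B
  proof -
    have "big ?W B" by (rule big1[OF V(3) B(4,5)]) (use c in simp)
    then show ?thesis using N_big[OF B(1,2)] formula[OF B(2,1)] B(3,6) by blast
  qed
  have flip: "even_in (cons c' (cons c V)) \<longleftrightarrow> \<not> even_in (cons c V)"
    by (rule even_cons[OF fin_cons[OF V(2)]]) (use c' in simp)
  have 1: "cons c V \<sqsubseteq> A" "cons c' (cons c V) \<sqsubseteq> A" "V \<sqsubseteq> cons c V" "V \<sqsubseteq> cons c' (cons c V)"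
    using V(1) c(1) c'(1) unfolding sub_in_def mem_cons by blast+
  have 2: "fin (cons c V)" "fin (cons c' (cons c V))" using V(2) fin_cons by blast+
  have 3: "\<not> x \<epsilon> ?W" if "x \<epsilon> cons c' (cons c V)" for x
    using that V(4) c(2) c'(2) unfolding mem_cons mem_un by blast
  show ?thesis
  proof (cases "even_in (cons c V)")
    case False show ?thesis by (rule odd[OF 1(1) 2(1) False 1(3)]) (use 3 in auto)
  next
    case True then show ?thesis using odd[OF 1(2) 2(2) _ 1(4) _ 3] flip by simp
  qed
qed

lemma fin_union_of: assumes "fin F" "\<And>S. S \<epsilon> F \<Longrightarrow> fin S" shows "fin (union_of F)"
proof -
  from assms(1) have "(\<forall>S. S \<epsilon> F \<longrightarrow> fin S) \<longrightarrow> fin (union_of F)"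
  proof (induction rule: fin_induct)
    case definable show ?case by (intro dfn)
  next
    case empty have "union_of \<zero> = \<zero>" by (rule extensionality) auto
    then show ?case using fin_empty by simp
  next
    case (cons F S)
    have "union_of (cons S F) = un (union_of F) S" by (rule extensionality) auto
    then show ?case using cons(3) fin_un by simp
  qed
  then show ?thesis using assms(2) by blast
qed

lemma even_copies:
  assumes A: "\<not> fin A" and base: "\<And>q. admissible A (union_of F') q \<zero> \<Longrightarrow> even_in (copies F' Y q)"
    and S: "fin S" "S \<sqsubseteq> union_of F'" and p: "admissible A (union_of F') p S"
  shows "even_in (copies F' Y p)"
proof -
  from S(1) have "S \<sqsubseteq> union_of F' \<longrightarrow> (\<forall>p. admissible A (union_of F') p S \<longrightarrow> even_in (copies F' Y p))"
  proof (induction rule: fin_induct)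
    case definable show ?case unfolding admissible_def by (intro dfn)
  next
    case empty show ?case using base by blast
  next
    case (cons S y)
    show ?case
    proof (intro impI allI)
      fix p assume sub: "cons y S \<sqsubseteq> union_of F'" and p: "admissible A (union_of F') p (cons y S)"
      have "y \<epsilon> union_of F'" "S \<sqsubseteq> union_of F'" using sub unfolding sub_in_def mem_cons by blast+
      then show "even_in (copies F' Y p)" using even_copies_step[OF A _ p] cons(2,3) by blast
    qed
  qed
  then show ?thesis using S(2) p by blast
qed

lemma identity_copies:
  assumes "fin (union_of F')" "union_of F' \<sqsubseteq> A" "F' \<epsilon> Y"
  shows "\<exists>p. admissible A (union_of F') p (union_of F') \<and> copies F' Y p = cons F' \<zero>"
proof -
  let ?D = "union_of F'"
  have "small (\<lambda>z. \<exists>x. x \<epsilon> ?D \<and> z = pair_in E x x)" by (rule small_image) (intro dfn)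
  then obtain p where p: "\<And>z. z \<epsilon> p \<longleftrightarrow> (\<exists>x. x \<epsilon> ?D \<and> z = pair_in E x x)"
    unfolding small_def by blast
  have rel: "rel p x d \<longleftrightarrow> x = d \<and> d \<epsilon> ?D" for x d unfolding p by auto
  have none: "X = X'" if "X \<sqsubseteq> sdiff ?D ?D" "X' \<sqsubseteq> sdiff ?D ?D" for X X'
    by (rule extensionality) (use that in \<open>unfold sub_in_def mem_sdiff, blast\<close>)
  have "preim p ?D = ?D" by (rule extensionality) (unfold mem_preim rel, blast)
  then have finp: "fin (preim p ?D)" using assms(1) by simp
  have "admissible A ?D p ?D" unfolding admissible_def
  proof (intro conjI allI impI)
    show "singleton_in E (fib p d)" if "d \<epsilon> ?D" for d
      unfolding singleton_in_def mem_preim rel mem_cons using that mem_empty by blast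
    show "fin (preim p ?D)" by (rule finp)
    show "x \<epsilon> A" if "rel p x d" for x d using that assms(2) unfolding rel sub_in_def by blast
    show "X = X'" if "X \<sqsubseteq> sdiff ?D ?D \<and> X' \<sqsubseteq> sdiff ?D ?D \<and> preim p X \<approx> preim p X'" for X X'
      using that none by blast
  qed (unfold rel mem_sdiff, blast+)
  moreover have "copies F' Y p = cons F' \<zero>"
  proof (rule extensionality, intro allI)
    fix F
    have img: "isimg p S S' \<longleftrightarrow> S = S'" if "S \<sqsubseteq> ?D" for S S'
      using that unfolding isimg_def rel ext_iff[of S S'] sub_in_def by blast
    have "copy p F' F \<longleftrightarrow> F = F'"
    proof
      assume c: "copy p F' F"
      then have "\<And>x. x \<epsilon> union_of F \<Longrightarrow> x \<epsilon> ?D" unfolding copy_def rel by blast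
      then have sub: "S \<sqsubseteq> ?D" if "S \<epsilon> F" for S using that unfolding sub_in_def mem_union_of by blast
      show "F = F'"
      proof (rule extensionality, intro allI iffI)
        fix S assume S: "S \<epsilon> F"
        then obtain S' where "S' \<epsilon> F'" "isimg p S S'" using c unfolding copy_def by blast
        then show "S \<epsilon> F'" using img[OF sub[OF S]] by simp
      next
        fix S' assume "S' \<epsilon> F'"
        then obtain S where S: "S \<epsilon> F" "isimg p S S'" using c unfolding copy_def by blast
        then show "S' \<epsilon> F" using img[OF sub[OF S(1)]] by simp
      qed
    next
      assume F: "F = F'"
      have "S \<sqsubseteq> ?D" if "S \<epsilon> F'" for S using that unfolding sub_in_def mem_union_of by blast
      then have i: "isimg p S S" if "S \<epsilon> F'" for S using img that by blast
      show "copy p F' F" unfolding F copy_def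
        by (intro conjI allI impI) (use i in \<open>unfold rel, blast+\<close>)
    qed
    then show "F \<epsilon> copies F' Y p \<longleftrightarrow> F \<epsilon> cons F' \<zero>" using assms(3) by auto
  qed
  ultimately show ?thesis by blast
qed

section \<open>Decoding partitions\<close>

text \<open>The blocks that are read as fibres. Tags are excluded by the requirement of a unique size.\<close>

definition marked :: "'v \<Rightarrow> 'v \<Rightarrow> bool" where
  "marked P b \<longleftrightarrow> b \<epsilon> P \<and> \<not> singleton_in E b \<and> (\<forall>c. c \<epsilon> P \<and> c \<approx> b \<longrightarrow> c = b)"

definition hull :: "'v \<Rightarrow> 'v \<Rightarrow> 'v" where
  "hull P S = coll E (\<lambda>x. \<exists>b. marked P b \<and> x \<epsilon> b \<and> (\<exists>u. u \<epsilon> b \<and> u \<epsilon> S))"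

lemma mem_hull: "x \<epsilon> hull P S \<longleftrightarrow> (\<exists>b. marked P b \<and> x \<epsilon> b \<and> (\<exists>u. u \<epsilon> b \<and> u \<epsilon> S))"
  unfolding hull_def
  by (rule mem_coll_small, rule small_sub[OF _ small_mem[of "union_of P"]])
    (unfold marked_def, intro dfn, auto)

lemma dterm_hull [dfn]: "dterm s \<Longrightarrow> dterm t \<Longrightarrow> dterm (\<lambda>e. hull (s e) (t e))"
  by (rule dterm_app2[where f = hull]) (rule dterm_coll, rule mem_hull, unfold marked_def, intro dfn)

text \<open>
  \<open>hull P S\<close> is the union of the fibres that meet \<open>S\<close>. So \<open>P\<close> decodes to \<open>F\<close> if the union of \<open>F\<close> picks
  one point from each fibre and the members of \<open>F\<close> are the sets of such points whose
  fibres are tagged. A transversal of the fibres thus determines at most one \<open>F\<close>.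
\<close>

definition decodes :: "'v \<Rightarrow> 'v \<Rightarrow> bool" where
  "decodes P F \<longleftrightarrow>
     (\<forall>b. marked P b \<longrightarrow> (\<exists>x. x \<epsilon> b \<and> x \<epsilon> union_of F)) \<and>
     (\<forall>b x x'. marked P b \<and> x \<epsilon> b \<and> x \<epsilon> union_of F \<and> x' \<epsilon> b \<and> x' \<epsilon> union_of F \<longrightarrow> x = x') \<and>
     (\<forall>x. x \<epsilon> union_of F \<longrightarrow> (\<exists>b. marked P b \<and> x \<epsilon> b)) \<and>
     (\<forall>S. S \<epsilon> F \<longleftrightarrow> S \<sqsubseteq> union_of F \<and> (\<exists>t. t \<epsilon> P \<and> t \<approx> plus_two (hull P S)))"

definition decoded :: "'v \<Rightarrow> 'v \<Rightarrow> 'v" where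
  "decoded P X = coll E (\<lambda>F. F \<epsilon> X \<and> decodes P F)"

lemma mem_decoded [simp]: "F \<epsilon> decoded P X \<longleftrightarrow> F \<epsilon> X \<and> decodes P F"
  unfolding decoded_def
  by (rule mem_coll_small, rule small_comp) (unfold decodes_def marked_def, intro dfn)

lemma dterm_decoded [dfn]: "dterm s \<Longrightarrow> dterm t \<Longrightarrow> dterm (\<lambda>e. decoded (s e) (t e))"
  by (rule dterm_app2[where f = decoded])
    (rule dterm_coll, rule mem_decoded, unfold decodes_def marked_def, intro dfn)

text \<open>The points of a decoded family lie in the finitely many non-singleton blocks.\<close>

lemma fin_decoded: assumes "P \<epsilon> Bfin_in E A" shows "fin (decoded P X)"
proof -
  let ?U = "union_of (nonsingletons_in E P)"
  have "fin ?U" by (rule fin_union_of) (use assms in auto)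
  then have "fin (Pow_in E (Pow_in E ?U))" using fin_Pow by blast
  then show ?thesis
  proof (rule fin_sub)
    have "F \<epsilon> Pow_in E (Pow_in E ?U)" if F: "decodes P F" for F
    proof -
      have "x \<epsilon> ?U" if x: "x \<epsilon> union_of F" for x
      proof -
        obtain b where "b \<epsilon> nonsingletons_in E P" "x \<epsilon> b"
          using F x unfolding decodes_def marked_def mem_nonsingletons by blast
        then show ?thesis unfolding mem_union_of by blast
      qed
      then have "S \<sqsubseteq> ?U" if "S \<epsilon> F" for S using that unfolding sub_in_def mem_union_of[of _ F] by blast
      then show ?thesis unfolding mem_Pow sub_in_def[of E F] by blast
    qed
    then show "decoded P X \<sqsubseteq> Pow_in E (Pow_in E ?U)"
      unfolding sub_in_def[of E "decoded P X"] mem_decoded by blast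
  qed
qed

lemma even_decoded_un:
  assumes "P \<epsilon> Bfin_in E A" "\<And>F. \<not> (F \<epsilon> X \<and> F \<epsilon> Z)"
  shows "even_in (decoded P (un X Z)) \<longleftrightarrow> (even_in (decoded P X) \<longleftrightarrow> even_in (decoded P Z))"
proof -
  have "decoded P (un X Z) = un (decoded P X) (decoded P Z)" by (rule extensionality) auto
  moreover have "\<not> (F \<epsilon> decoded P X \<and> F \<epsilon> decoded P Z)" for F
    unfolding mem_decoded using assms(2) by blast
  ultimately show ?thesis using even_un[OF fin_decoded[OF assms(1)] fin_decoded[OF assms(1)]] by simp
qed

text \<open>
  If the marked blocks are the fibres of \<open>p\<close> and exactly the members of \<open>F'\<close> are tagged, then the
  transversals read off \<open>P\<close> are those of \<open>p\<close>, and decoding means transporting \<open>F'\<close> along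
  a transversal.
\<close>

lemma decodes_iff_copy:
  assumes marked: "\<And>b. marked P b \<longleftrightarrow> (\<exists>d. d \<epsilon> union_of F' \<and> b = fib p d)"
    and D: "\<And>x d. rel p x d \<Longrightarrow> d \<epsilon> union_of F'"
    and func: "\<And>x d d'. rel p x d \<Longrightarrow> rel p x d' \<Longrightarrow> d = d'"
    and tags: "\<And>S S'. S' \<sqsubseteq> union_of F' \<Longrightarrow> (\<exists>t. t \<epsilon> P \<and> t \<approx> plus_two (preim p S')) \<longleftrightarrow> S' \<epsilon> F'"
  shows "decodes P F \<longleftrightarrow> copy p F' F"
proof -
  have fib: "x \<epsilon> fib p d \<longleftrightarrow> rel p x d" for x d by simp
  have hull: "hull P S = preim p S'" if "isimg p S S'" for S S'
  proof (rule extensionality, intro allI)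
    fix x
    have "x \<epsilon> hull P S \<longleftrightarrow> (\<exists>d. d \<epsilon> union_of F' \<and> rel p x d \<and> (\<exists>u. rel p u d \<and> u \<epsilon> S))"
      unfolding mem_hull marked using fib by metis
    also have "\<dots> \<longleftrightarrow> x \<epsilon> preim p S'" using that D unfolding isimg_def mem_preim by blast
    finally show "x \<epsilon> hull P S \<longleftrightarrow> x \<epsilon> preim p S'" .
  qed
  have tag: "(\<exists>t. t \<epsilon> P \<and> t \<approx> plus_two (hull P S)) \<longleftrightarrow> S' \<epsilon> F'" if "isimg p S S'" for S S'
  proof -
    have "S' \<sqsubseteq> union_of F'" using that D unfolding isimg_def sub_in_def by blast
    then show ?thesis unfolding hull[OF that] by (rule tags)
  qed
  have image: "\<exists>S'. isimg p S S'" for S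
  proof -
    have "small (\<lambda>d. d \<epsilon> union_of F' \<and> (\<exists>x. x \<epsilon> S \<and> rel p x d))" by (rule small_comp) (intro dfn)
    then show ?thesis unfolding small_def isimg_def using D by blast
  qed
  show ?thesis
  proof
    assume dec: "decodes P F"
    have onto: "\<exists>x. x \<epsilon> union_of F \<and> rel p x d" if "d \<epsilon> union_of F'" for d
    proof -
      have "marked P (fib p d)" using marked that by blast
      then obtain x where "x \<epsilon> fib p d" "x \<epsilon> union_of F" using dec unfolding decodes_def by blast
      then show ?thesis unfolding fib by blast
    qed
    show "copy p F' F" unfolding copy_def
    proof (intro conjI allI impI)
      fix x assume "x \<epsilon> union_of F"
      then obtain b where "marked P b" "x \<epsilon> b" using dec unfolding decodes_def by blast
      then show "\<exists>d. rel p x d" unfolding marked using fib by blast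
    next
      fix x x' d assume h: "x \<epsilon> union_of F \<and> x' \<epsilon> union_of F \<and> rel p x d \<and> rel p x' d"
      then have "marked P (fib p d)" using marked D by blast
      moreover have "x \<epsilon> fib p d" "x' \<epsilon> fib p d" using h unfolding fib by blast+
      ultimately show "x = x'" using dec h unfolding decodes_def by blast
    next
      fix S assume "S \<epsilon> F"
      then have "\<exists>t. t \<epsilon> P \<and> t \<approx> plus_two (hull P S)" using dec unfolding decodes_def by blast
      then show "\<exists>S'. S' \<epsilon> F' \<and> isimg p S S'" using image tag by blast
    next
      fix S' assume S': "S' \<epsilon> F'"
      have "small (\<lambda>x. x \<epsilon> union_of F \<and> (\<exists>d. d \<epsilon> S' \<and> rel p x d))" by (rule small_comp) (intro dfn)
      then obtain S where S: "\<And>x. x \<epsilon> S \<longleftrightarrow> x \<epsilon> union_of F \<and> (\<exists>d. d \<epsilon> S' \<and> rel p x d)"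
        unfolding small_def by blast
      have "d \<epsilon> union_of F'" if "d \<epsilon> S'" for d using that S' unfolding mem_union_of by blast
      then have i: "isimg p S S'" unfolding isimg_def S using onto func by blast
      have "S \<sqsubseteq> union_of F" unfolding sub_in_def S by blast
      then have "S \<epsilon> F" using dec tag[OF i] S' unfolding decodes_def by blast
      then show "\<exists>S. S \<epsilon> F \<and> isimg p S S'" using i by blast
    qed
  next
    assume c: "copy p F' F"
    have inj: "x = x'" if "x \<epsilon> union_of F" "x' \<epsilon> union_of F" "rel p x d" "rel p x' d" for x x' d
      using c that unfolding copy_def by blast
    show "decodes P F" unfolding decodes_def
    proof (intro conjI allI impI)
      fix b assume "marked P b"
      then obtain d where d: "d \<epsilon> union_of F'" "b = fib p d" using marked by blast
      then show "\<exists>x. x \<epsilon> b \<and> x \<epsilon> union_of F" using copy_hits_fibre[OF c d(1)] fib by blast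
    next
      fix b x x' assume h: "marked P b \<and> x \<epsilon> b \<and> x \<epsilon> union_of F \<and> x' \<epsilon> b \<and> x' \<epsilon> union_of F"
      then obtain d where d: "b = fib p d" using marked by blast
      then have "rel p x d" "rel p x' d" using h fib by blast+
      then show "x = x'" using inj h by blast
    next
      fix x assume "x \<epsilon> union_of F"
      then obtain d where d: "rel p x d" using c unfolding copy_def by blast
      then have "marked P (fib p d)" using marked D by blast
      then show "\<exists>b. marked P b \<and> x \<epsilon> b" using d fib by blast
    next
      fix S
      show "S \<epsilon> F \<longleftrightarrow> S \<sqsubseteq> union_of F \<and> (\<exists>t. t \<epsilon> P \<and> t \<approx> plus_two (hull P S))"
      proof
        assume S: "S \<epsilon> F"
        then obtain S' where "S' \<epsilon> F'" "isimg p S S'" using c unfolding copy_def by blast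
        moreover have "S \<sqsubseteq> union_of F" using S unfolding sub_in_def mem_union_of by blast
        ultimately show "S \<sqsubseteq> union_of F \<and> (\<exists>t. t \<epsilon> P \<and> t \<approx> plus_two (hull P S))" using tag by blast
      next
        assume S: "S \<sqsubseteq> union_of F \<and> (\<exists>t. t \<epsilon> P \<and> t \<approx> plus_two (hull P S))"
        obtain S' where i: "isimg p S S'" using image by blast
        then have "S' \<epsilon> F'" using tag S by blast
        then obtain R where R: "R \<epsilon> F" "isimg p R S'" using c unfolding copy_def by blast
        have RF: "R \<sqsubseteq> union_of F" using R(1) unfolding sub_in_def mem_union_of by blast
        have sub: "x \<epsilon> R2" if h: "isimg p R1 S'" "isimg p R2 S'" "R1 \<sqsubseteq> union_of F" "R2 \<sqsubseteq> union_of F" "x \<epsilon> R1"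
          for R1 R2 x
        proof -
          have xF: "x \<epsilon> union_of F" using h(3,5) unfolding sub_in_def by blast
          then obtain d where d: "rel p x d" using c unfolding copy_def by blast
          then have "d \<epsilon> S'" using h(1,5) unfolding isimg_def by blast
          then obtain x' where x': "x' \<epsilon> R2" "rel p x' d" using h(2) unfolding isimg_def by blast
          then have "x = x'" using inj xF d h(4) unfolding sub_in_def by blast
          then show ?thesis using x'(1) by simp
        qed
        have "S = R" by (rule extensionality) (use sub i R(2) S RF in blast)
        then show "S \<epsilon> F" using R(1) by simp
      qed
    qed
  qed
qed

lemma plus_two_nontrivial:
  assumes "t \<approx> plus_two X" shows "\<exists>x. x \<epsilon> t" "\<not> singleton_in E t"
proof -
  have eq: "cons (succ_in E X) (cons X X) \<approx> t"
    using eqpoll_sym[OF assms] by (simp only: succ_eq_cons)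
  have "\<not> succ_in E X \<epsilon> cons X X" using mem_irrefl[of "succ_in E X"] by (simp add: succ_eq_cons)
  then obtain b where b: "b \<epsilon> t" "cons X X \<approx> del b t" using eqpoll_cons_left[OF eq] by blast
  show "\<exists>x. x \<epsilon> t" using b(1) by blast
  obtain c where c: "c \<epsilon> del b t" using eqpoll_cons_left[OF b(2) mem_irrefl] by blast
  then show "\<not> singleton_in E t" using b(1) unfolding singleton_in_def mem_del by metis
qed

lemma singleton_eqpoll: assumes "singleton_in E s" "s \<approx> t" shows "singleton_in E t"
proof -
  obtain a where "s = cons a \<zero>" using assms(1) unfolding singleton_in_def by (auto simp: ext_iff[of s])
  then obtain b where b: "b \<epsilon> t" "\<zero> \<approx> del b t" using eqpoll_cons_left assms(2) mem_empty by blast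
  then have "del b t = \<zero>" using eqpoll_sym eqpoll_empty by blast
  then have "z \<epsilon> t \<longleftrightarrow> z = b" for z using b(1) mem_del[of z b t] by auto
  then show ?thesis unfolding singleton_in_def by blast
qed

text \<open>
  Each tag comes with a twin of the same size, so that no tag is mistaken for a fibre.
\<close>

lemma tags_exist:
  assumes A: "\<not> fin A" and U: "fin U" and p: "\<And>S. fin (preim p S)" and G: "fin G"
  shows "\<exists>T. fin T \<and> (\<forall>t. t \<epsilon> T \<longrightarrow> t \<sqsubseteq> A \<and> fin t \<and> (\<forall>x. x \<epsilon> t \<longrightarrow> \<not> x \<epsilon> U) \<and>
        (\<exists>S. S \<epsilon> G \<and> t \<approx> plus_two (preim p S)) \<and> (\<exists>t'. t' \<epsilon> T \<and> t' \<noteq> t \<and> t' \<approx> t)) \<and>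
      (\<forall>t t' x. t \<epsilon> T \<and> t' \<epsilon> T \<and> x \<epsilon> t \<and> x \<epsilon> t' \<longrightarrow> t = t') \<and>
      (\<forall>S. S \<epsilon> G \<longrightarrow> (\<exists>t. t \<epsilon> T \<and> t \<approx> plus_two (preim p S)))"
  using G
proof (induction rule: fin_induct)
  case definable show ?case by (intro dfn)
next
  case empty show ?case by (intro exI[of _ \<zero>]) (auto simp: fin_empty)
next
  case (cons G S)
  then obtain T where finT: "fin T"
    and T: "\<And>t. t \<epsilon> T \<Longrightarrow> t \<sqsubseteq> A \<and> fin t \<and> (\<forall>x. x \<epsilon> t \<longrightarrow> \<not> x \<epsilon> U) \<and>
        (\<exists>S. S \<epsilon> G \<and> t \<approx> plus_two (preim p S)) \<and> (\<exists>t'. t' \<epsilon> T \<and> t' \<noteq> t \<and> t' \<approx> t)"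
    and Tdisj: "\<And>t t' x. t \<epsilon> T \<Longrightarrow> t' \<epsilon> T \<Longrightarrow> x \<epsilon> t \<Longrightarrow> x \<epsilon> t' \<Longrightarrow> t = t'"
    and TG: "\<And>S. S \<epsilon> G \<Longrightarrow> \<exists>t. t \<epsilon> T \<and> t \<approx> plus_two (preim p S)" by blast
  let ?K = "plus_two (preim p S)"
  have finK: "fin ?K" using fin_plus_two p by blast
  have finUT: "fin (un U (union_of T))" using fin_un fin_union_of finT T U by blast
  obtain t1 where t1: "t1 \<sqsubseteq> A" "t1 \<approx> ?K" "\<And>x. x \<epsilon> t1 \<Longrightarrow> \<not> x \<epsilon> un U (union_of T)"
    using fresh_copy[OF A finUT finK] by blast
  have fin1: "fin t1" using t1(2) fin_eqpoll[OF finK] eqpoll_sym by blast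
  obtain t2 where t2: "t2 \<sqsubseteq> A" "t2 \<approx> ?K" "\<And>x. x \<epsilon> t2 \<Longrightarrow> \<not> x \<epsilon> un (un U (union_of T)) t1"
    using fresh_copy[OF A fin_un[OF fin1 finUT] finK] by blast
  have fin2: "fin t2" using t2(2) fin_eqpoll[OF finK] eqpoll_sym by blast
  have d1: "\<And>x. x \<epsilon> t1 \<Longrightarrow> \<not> x \<epsilon> U" "\<And>x t. x \<epsilon> t1 \<Longrightarrow> t \<epsilon> T \<Longrightarrow> \<not> x \<epsilon> t"
    using t1(3) unfolding mem_un mem_union_of by blast+
  have d2: "\<And>x. x \<epsilon> t2 \<Longrightarrow> \<not> x \<epsilon> U" "\<And>x t. x \<epsilon> t2 \<Longrightarrow> t \<epsilon> T \<Longrightarrow> \<not> x \<epsilon> t"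
    "\<And>x. x \<epsilon> t2 \<Longrightarrow> \<not> x \<epsilon> t1"
    using t2(3) unfolding mem_un mem_union_of by blast+
  have ne: "t1 \<noteq> t2" using d2(3) plus_two_nontrivial(1)[OF t2(2)] by blast
  have e12: "t1 \<approx> t2" "t2 \<approx> t1" using t1(2) t2(2) eqpoll_sym eqpoll_trans by blast+
  let ?T = "cons t1 (cons t2 T)"
  show ?case
  proof (rule exI[of _ ?T], intro conjI allI impI)
    show "fin ?T" using finT fin_cons by blast
  next
    fix t t' x assume "t \<epsilon> ?T \<and> t' \<epsilon> ?T \<and> x \<epsilon> t \<and> x \<epsilon> t'"
    then show "t = t'" using Tdisj d1(2) d2(2,3) unfolding mem_cons by blast
  next
    fix S' assume "S' \<epsilon> cons S G"
    then show "\<exists>t. t \<epsilon> ?T \<and> t \<approx> plus_two (preim p S')" using TG t1(2) unfolding mem_cons by blast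
  next
    fix t assume t: "t \<epsilon> ?T"
    show "t \<sqsubseteq> A" using t T t1(1) t2(1) unfolding mem_cons by blast
    show "fin t" using t T fin1 fin2 unfolding mem_cons by blast
    show "\<not> x \<epsilon> U" if "x \<epsilon> t" for x using t T d1(1) d2(1) that unfolding mem_cons by blast
    show "\<exists>S'. S' \<epsilon> cons S G \<and> t \<approx> plus_two (preim p S')"
      using t T t1(2) t2(2) unfolding mem_cons by blast
    show "\<exists>t'. t' \<epsilon> ?T \<and> t' \<noteq> t \<and> t' \<approx> t" using t T ne e12 unfolding mem_cons by blast
  qed
qed

text \<open>
  The partition consists of the fibres, the tags, and a singleton for each remaining point of \<open>A\<close>. The
  last two conditions of \<open>admissible\<close> ensure that fibres have sizes of their own and that a tagged set
  is a member of \<open>F'\<close>.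
\<close>

lemma partition_of_admissible:
  assumes A: "\<not> fin A" and F': "fin F'" "fin (union_of F')" and p: "admissible A (union_of F') p \<zero>"
  shows "\<exists>P. P \<epsilon> Bfin_in E A \<and> (\<forall>F. decodes P F \<longleftrightarrow> copy p F' F)"
proof -
  let ?D = "union_of F'" and ?U = "preim p (union_of F')"
  have full: "X \<sqsubseteq> sdiff ?D \<zero> \<longleftrightarrow> X \<sqsubseteq> ?D" "d \<epsilon> sdiff ?D \<zero> \<longleftrightarrow> d \<epsilon> ?D" for X d
    unfolding sub_in_def mem_sdiff using mem_empty by blast+
  have p1: "\<And>x d. rel p x d \<Longrightarrow> x \<epsilon> A \<and> d \<epsilon> ?D"
    and p2: "\<And>x d d'. rel p x d \<Longrightarrow> rel p x d' \<Longrightarrow> d = d'"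
    and p3: "fin ?U"
    and p5: "\<And>d. d \<epsilon> ?D \<Longrightarrow> \<not> singleton_in E (fib p d)"
    and p6: "\<And>X X'. X \<sqsubseteq> ?D \<Longrightarrow> X' \<sqsubseteq> ?D \<Longrightarrow> preim p X \<approx> preim p X' \<Longrightarrow> X = X'"
    and p7: "\<And>X d. X \<sqsubseteq> ?D \<Longrightarrow> d \<epsilon> ?D \<Longrightarrow> \<not> fib p d \<approx> plus_two (preim p X)"
    using p mem_empty unfolding admissible_def full by blast+
  have fib: "x \<epsilon> fib p d \<longleftrightarrow> rel p x d" for x d by simp
  have preU: "preim p S \<sqsubseteq> ?U" for S unfolding sub_in_def mem_preim using p1 by blast
  have finpre: "fin (preim p S)" for S using fin_sub[OF p3 preU] .
  have single_sub: "cons d \<zero> \<sqsubseteq> ?D" if "d \<epsilon> ?D" for d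
    unfolding sub_in_def mem_cons using that mem_empty by blast
  have fib_ne: "\<exists>x. rel p x d" if "d \<epsilon> ?D" for d
  proof (rule ccontr)
    assume "\<nexists>x. rel p x d"
    then have "fib p d = preim p \<zero>" by (intro extensionality) auto
    moreover have "\<zero> \<sqsubseteq> ?D" unfolding sub_in_def using mem_empty by blast
    ultimately have "cons d \<zero> = \<zero>" using p6[OF single_sub[OF that]] eqpoll_refl by metis
    then show False using mem_cons[of d d \<zero>] mem_empty by metis
  qed
  have memF': "S \<sqsubseteq> ?D" if "S \<epsilon> F'" for S using that unfolding sub_in_def mem_union_of by blast
  obtain T where finT: "fin T"
    and T: "\<And>t. t \<epsilon> T \<Longrightarrow> t \<sqsubseteq> A \<and> fin t \<and> (\<forall>x. x \<epsilon> t \<longrightarrow> \<not> x \<epsilon> ?U) \<and>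
        (\<exists>S. S \<epsilon> F' \<and> t \<approx> plus_two (preim p S)) \<and> (\<exists>t'. t' \<epsilon> T \<and> t' \<noteq> t \<and> t' \<approx> t)"
    and Tdisj: "\<And>t t' x. t \<epsilon> T \<Longrightarrow> t' \<epsilon> T \<Longrightarrow> x \<epsilon> t \<Longrightarrow> x \<epsilon> t' \<Longrightarrow> t = t'"
    and TF: "\<And>S. S \<epsilon> F' \<Longrightarrow> \<exists>t. t \<epsilon> T \<and> t \<approx> plus_two (preim p S)"
    using tags_exist[OF A p3 finpre F'(1)] by blast
  have "small (\<lambda>b. (\<exists>d. d \<epsilon> ?D \<and> b = fib p d) \<or> b \<epsilon> T \<or>
      (\<exists>x. x \<epsilon> sdiff A (un ?U (union_of T)) \<and> b = cons x \<zero>))"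
    by (intro small_un small_mem small_image dfn)
  then obtain P where P: "\<And>b. b \<epsilon> P \<longleftrightarrow> (\<exists>d. d \<epsilon> ?D \<and> b = fib p d) \<or> b \<epsilon> T \<or>
      (\<exists>x. x \<epsilon> sdiff A (un ?U (union_of T)) \<and> b = cons x \<zero>)"
    unfolding small_def by blast
  have P_cases: "(\<And>d. d \<epsilon> ?D \<Longrightarrow> b = fib p d \<Longrightarrow> Q) \<Longrightarrow> (b \<epsilon> T \<Longrightarrow> Q) \<Longrightarrow>
      (\<And>a. a \<epsilon> A \<Longrightarrow> \<not> a \<epsilon> ?U \<Longrightarrow> \<not> a \<epsilon> union_of T \<Longrightarrow> b = cons a \<zero> \<Longrightarrow> Q) \<Longrightarrow> Q" if "b \<epsilon> P" for b Q
    using that unfolding P mem_sdiff mem_un by blast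
  have single: "singleton_in E (cons x \<zero>)" for x unfolding singleton_in_def by auto
  have T_ns: "\<not> singleton_in E t" "\<exists>x. x \<epsilon> t" if t: "t \<epsilon> T" for t
  proof -
    obtain S where "t \<approx> plus_two (preim p S)" using T[OF t] by blast
    then show "\<not> singleton_in E t" "\<exists>x. x \<epsilon> t" using plus_two_nontrivial by blast+
  qed
  have inU: "x \<epsilon> ?U" if "rel p x d" for x d using that p1 unfolding mem_preim by blast
  have disj: "b = c" if b: "b \<epsilon> P" and c: "c \<epsilon> P" and xb: "x \<epsilon> b" and xc: "x \<epsilon> c" for b c x
    using b
  proof (rule P_cases)
    fix d assume d: "d \<epsilon> ?D" "b = fib p d"
    then have xd: "rel p x d" using xb fib by blast
    show ?thesis using c
    proof (rule P_cases)
      fix d' assume d': "c = fib p d'"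
      then have "rel p x d'" using xc fib by blast
      then show ?thesis using p2 xd d(2) d' by blast
    next
      assume "c \<epsilon> T" then show ?thesis using T xc inU[OF xd] by blast
    next
      fix a assume "c = cons a \<zero>" "\<not> a \<epsilon> ?U"
      then show ?thesis using xc inU[OF xd] unfolding \<open>c = cons a \<zero>\<close> mem_cons using mem_empty by blast
    qed
  next
    assume bT: "b \<epsilon> T"
    show ?thesis using c
    proof (rule P_cases)
      fix d assume "c = fib p d"
      then have "rel p x d" using xc fib by blast
      then show ?thesis using T[OF bT] xb inU by blast
    next
      assume "c \<epsilon> T" then show ?thesis using Tdisj bT xb xc by blast
    next
      fix a assume a: "c = cons a \<zero>" "\<not> a \<epsilon> union_of T"
      then have "x = a" using xc by simp
      then show ?thesis using a(2) bT xb unfolding mem_union_of by blast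
    qed
  next
    fix a assume a: "b = cons a \<zero>" "\<not> a \<epsilon> union_of T" "\<not> a \<epsilon> ?U"
    then have xa: "x = a" using xb by simp
    show ?thesis using c
    proof (rule P_cases)
      fix d assume "c = fib p d"
      then have "rel p x d" using xc fib by blast
      then show ?thesis using a(3) inU xa by blast
    next
      assume "c \<epsilon> T" then show ?thesis using a(2) xc xa unfolding mem_union_of by blast
    next
      fix a' assume a': "c = cons a' \<zero>"
      then have "x = a'" using xc by simp
      then show ?thesis using a a' xa by simp
    qed
  qed
  have block: "(\<exists>x. x \<epsilon> b) \<and> b \<sqsubseteq> A \<and> fin b" if "b \<epsilon> P" for b
    using that
  proof (rule P_cases)
    fix d assume d: "d \<epsilon> ?D" "b = fib p d"
    show ?thesis unfolding d(2) sub_in_def fib using fib_ne[OF d(1)] p1 finpre by blast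
  next
    assume "b \<epsilon> T" then show ?thesis using T T_ns by blast
  next
    fix a assume "a \<epsilon> A" "b = cons a \<zero>"
    then show ?thesis using fin_cons[OF fin_empty] by (auto simp: sub_in_def)
  qed
  have cover: "\<exists>b. b \<epsilon> P \<and> x \<epsilon> b" if "x \<epsilon> A" for x
  proof -
    consider "x \<epsilon> ?U" | "x \<epsilon> union_of T" | "x \<epsilon> sdiff A (un ?U (union_of T))"
      using \<open>x \<epsilon> A\<close> unfolding mem_sdiff mem_un by blast
    then show ?thesis
    proof cases
      case 1
      then obtain d where d: "d \<epsilon> ?D" "rel p x d" unfolding mem_preim by blast
      then have "fib p d \<epsilon> P" "x \<epsilon> fib p d" unfolding P fib by blast+
      then show ?thesis by blast
    next
      case 2 then show ?thesis unfolding mem_union_of P by blast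
    next
      case 3
      then have "cons x \<zero> \<epsilon> P" unfolding P by blast
      then show ?thesis by (intro exI[of _ "cons x \<zero>"]) simp
    qed
  qed
  have "small (\<lambda>b. \<exists>d. d \<epsilon> ?D \<and> b = fib p d)" by (intro small_image dfn)
  then obtain I where I: "\<And>b. b \<epsilon> I \<longleftrightarrow> (\<exists>d. d \<epsilon> ?D \<and> b = fib p d)" unfolding small_def by blast
  have "fin I" by (rule fin_image[OF F'(2), of "fib p"]) (intro dfn, use I in blast)
  then have "fin (un I T)" using fin_un finT by blast
  then have "fin (nonsingletons_in E P)"
  proof (rule fin_sub)
    show "nonsingletons_in E P \<sqsubseteq> un I T"
      unfolding sub_in_def mem_nonsingletons mem_un P I using single by blast
  qed
  moreover have "partition_in E A P" unfolding partition_in_def using block disj cover by blast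
  ultimately have Bfin: "P \<epsilon> Bfin_in E A" unfolding mem_Bfin using block by blast
  have tag: "(\<exists>t. t \<epsilon> P \<and> t \<approx> plus_two (preim p S)) \<longleftrightarrow> S \<epsilon> F'" if S: "S \<sqsubseteq> ?D" for S
  proof
    assume "\<exists>t. t \<epsilon> P \<and> t \<approx> plus_two (preim p S)"
    then obtain t where t: "t \<epsilon> P" "t \<approx> plus_two (preim p S)" by blast
    show "S \<epsilon> F'" using t(1)
    proof (rule P_cases)
      fix d assume "d \<epsilon> ?D" "t = fib p d" then show ?thesis using p7[OF S] t(2) by blast
    next
      assume "t \<epsilon> T"
      then obtain S' where S': "S' \<epsilon> F'" "t \<approx> plus_two (preim p S')" using T by blast
      then have "plus_two (preim p S) \<approx> plus_two (preim p S')" using t(2) eqpoll_sym eqpoll_trans by blast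
      then have "S = S'" using p6 S memF'[OF S'(1)] plus_two_eqpoll_iff by blast
      then show ?thesis using S'(1) by simp
    next
      fix a assume "t = cons a \<zero>"
      then show ?thesis using plus_two_nontrivial(2)[OF t(2)] single by blast
    qed
  next
    assume "S \<epsilon> F'" then show "\<exists>t. t \<epsilon> P \<and> t \<approx> plus_two (preim p S)" using TF P by blast
  qed
  have "marked P b \<longleftrightarrow> (\<exists>d. d \<epsilon> ?D \<and> b = fib p d)" for b
  proof
    assume m: "marked P b"
    then have "b \<epsilon> P" "\<not> singleton_in E b" unfolding marked_def by blast+
    moreover have "\<not> b \<epsilon> T"
    proof
      assume "b \<epsilon> T"
      then obtain t' where "t' \<epsilon> T" "t' \<noteq> b" "t' \<approx> b" using T by blast
      then show False using m P unfolding marked_def by blast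
    qed
    ultimately show "\<exists>d. d \<epsilon> ?D \<and> b = fib p d" unfolding P using single by blast
  next
    assume "\<exists>d. d \<epsilon> ?D \<and> b = fib p d"
    then obtain d where d: "d \<epsilon> ?D" "b = fib p d" by blast
    show "marked P b" unfolding marked_def
    proof (intro conjI allI impI)
      show "b \<epsilon> P" using P d by blast
      show "\<not> singleton_in E b" using p5 d by blast
      fix c assume "c \<epsilon> P \<and> c \<approx> b"
      then have c: "c \<epsilon> P" and cb: "c \<approx> b" by blast+
      show "c = b" using c
      proof (rule P_cases)
        fix d' assume d': "d' \<epsilon> ?D" "c = fib p d'"
        then have "cons d' \<zero> = cons d \<zero>" using p6 single_sub d cb by blast
        then show ?thesis using d' d by simp
      next
        assume "c \<epsilon> T"
        then obtain S where S: "S \<epsilon> F'" "c \<approx> plus_two (preim p S)" using T by blast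
        then have "fib p d \<approx> plus_two (preim p S)" using cb d(2) eqpoll_sym eqpoll_trans by blast
        then show ?thesis using p7[OF memF'[OF S(1)] d(1)] by blast
      next
        fix a assume "c = cons a \<zero>"
        then have "singleton_in E b" using singleton_eqpoll single cb by blast
        then show ?thesis using p5 d by blast
      qed
    qed
  qed
  then have "decodes P F \<longleftrightarrow> copy p F' F" for F
    by (rule decodes_iff_copy) (use p1 p2 tag in blast)+
  then show ?thesis using Bfin by blast
qed

section \<open>The two injections\<close>

definition odd_code :: "'v \<Rightarrow> 'v \<Rightarrow> 'v" where
  "odd_code A X = coll E (\<lambda>P. P \<epsilon> Bfin_in E A \<and> \<not> even_in (decoded P X))"

lemma mem_odd_code: "P \<epsilon> odd_code A X \<longleftrightarrow> P \<epsilon> Bfin_in E A \<and> \<not> even_in (decoded P X)"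
  unfolding odd_code_def by (rule mem_coll_small, rule small_comp) (intro dfn)

lemma dterm_odd_code: "dterm (\<lambda>e. odd_code A (e 0))"
  by (rule dterm_coll, rule mem_odd_code, intro dfn)

text \<open>
  An element \<open>F'\<close> of the symmetric difference \<open>Y\<close> is one copy of itself in the identity
  blurring, whereas \<open>even_copies\<close> makes the number of its copies in \<open>Y\<close> even.
\<close>

lemma odd_code_inj:
  assumes A: "\<not> fin A"
    and X: "X \<sqsubseteq> Fin_in E (Fin_in E A)" and X': "X' \<sqsubseteq> Fin_in E (Fin_in E A)"
    and eq: "odd_code A X = odd_code A X'"
  shows "X = X'"
proof (rule ccontr)
  assume "X \<noteq> X'"
  define Y where "Y = un (sdiff X X') (sdiff X' X)"
  obtain F' where F': "F' \<epsilon> Y" using \<open>X \<noteq> X'\<close> unfolding Y_def ext_iff[of X X'] mem_un mem_sdiff by blast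
  have FF: "F' \<epsilon> Fin_in E (Fin_in E A)"
    using F' X X' unfolding Y_def sub_in_def[of E X] sub_in_def[of E X'] mem_un mem_sdiff by blast
  then have S: "S \<sqsubseteq> A \<and> fin S" if "S \<epsilon> F'" for S
    using that by (auto simp: sub_in_def[of E F'])
  have finF': "fin F'" using FF by simp
  have finD: "fin (union_of F')" using fin_union_of[OF finF'] S by blast
  have DA: "union_of F' \<sqsubseteq> A" using S unfolding sub_in_def mem_union_of by blast
  have even_Y: "even_in (decoded P Y)" if P: "P \<epsilon> Bfin_in E A" for P
  proof -
    let ?I = "sdiff X (sdiff X X')"
    have 1: "X = un ?I (sdiff X X')" and 2: "X' = un ?I (sdiff X' X)" by (rule extensionality, auto)+
    have "even_in (decoded P X) \<longleftrightarrow> (even_in (decoded P ?I) \<longleftrightarrow> even_in (decoded P (sdiff X X')))"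
      by (subst 1, rule even_decoded_un[OF P]) auto
    moreover have "even_in (decoded P X') \<longleftrightarrow> (even_in (decoded P ?I) \<longleftrightarrow> even_in (decoded P (sdiff X' X)))"
      by (subst 2, rule even_decoded_un[OF P]) auto
    moreover have "even_in (decoded P Y) \<longleftrightarrow>
        (even_in (decoded P (sdiff X X')) \<longleftrightarrow> even_in (decoded P (sdiff X' X)))"
      unfolding Y_def by (rule even_decoded_un[OF P]) auto
    moreover have "even_in (decoded P X) \<longleftrightarrow> even_in (decoded P X')"
      using eq P unfolding ext_iff[of "odd_code A X"] mem_odd_code by blast
    ultimately show ?thesis by blast
  qed
  have base: "even_in (copies F' Y q)" if q: "admissible A (union_of F') q \<zero>" for q
  proof -
    obtain P where P: "P \<epsilon> Bfin_in E A" "\<And>F. decodes P F \<longleftrightarrow> copy q F' F"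
      using partition_of_admissible[OF A finF' finD q] by blast
    have "copies F' Y q = decoded P Y" by (rule extensionality) (simp add: P(2))
    then show ?thesis using even_Y P(1) by simp
  qed
  obtain p where p: "admissible A (union_of F') p (union_of F')" "copies F' Y p = cons F' \<zero>"
    using identity_copies[OF finD DA F'] by blast
  have "union_of F' \<sqsubseteq> union_of F'" by (simp add: sub_in_def)
  then have "even_in (copies F' Y p)" using even_copies[OF A base finD _ p(1)] by blast
  then show False unfolding p(2) using not_even_single by blast
qed

lemma dterm_nonsingletons [dfn]: "dterm s \<Longrightarrow> dterm (\<lambda>e. nonsingletons_in E (s e))"
  by (rule dterm_app1[where f = "nonsingletons_in E"])
    (rule dterm_coll, rule mem_nonsingletons, intro dfn)

definition nontrivial_parts :: "'v \<Rightarrow> 'v" where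
  "nontrivial_parts X = coll E (\<lambda>Q. \<exists>P. P \<epsilon> X \<and> Q = nonsingletons_in E P)"

lemma mem_nontrivial_parts: "Q \<epsilon> nontrivial_parts X \<longleftrightarrow> (\<exists>P. P \<epsilon> X \<and> Q = nonsingletons_in E P)"
  unfolding nontrivial_parts_def by (rule mem_coll_small, rule small_image) (intro dfn)

lemma dterm_nontrivial_parts: "dterm (\<lambda>e. nontrivial_parts (e 0))"
  by (rule dterm_coll, rule mem_nontrivial_parts, intro dfn)

text \<open>A singleton block of one partition cannot be covered in the other by a larger, hence common, block.\<close>

lemma nonsingletons_inj:
  assumes P: "partition_in E A P" "partition_in E A P'"
    and eq: "nonsingletons_in E P = nonsingletons_in E P'"
  shows "P = P'"
proof -
  have sub: "b \<epsilon> Q'" if Q: "partition_in E A Q" "partition_in E A Q'"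
      and eq: "nonsingletons_in E Q = nonsingletons_in E Q'" and b: "b \<epsilon> Q" for Q Q' b
  proof (cases "singleton_in E b")
    case False
    then show ?thesis using eq b unfolding ext_iff[of "nonsingletons_in E Q"] mem_nonsingletons by blast
  next
    case True
    then obtain x where x: "\<And>z. z \<epsilon> b \<longleftrightarrow> z = x" unfolding singleton_in_def by blast
    then have "x \<epsilon> A" using Q(1) b unfolding partition_in_def sub_in_def by blast
    then obtain c where c: "c \<epsilon> Q'" "x \<epsilon> c" using Q(2) unfolding partition_in_def by blast
    have "singleton_in E c"
    proof (rule ccontr)
      assume ns: "\<not> singleton_in E c"
      then have "c \<epsilon> Q" using eq c(1) unfolding ext_iff[of "nonsingletons_in E Q"] mem_nonsingletons by blast
      then have "b = c" using Q(1) b c(2) x unfolding partition_in_def by blast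
      then show False using ns True by simp
    qed
    then obtain y where y: "\<And>z. z \<epsilon> c \<longleftrightarrow> z = y" unfolding singleton_in_def by blast
    have "b = c" by (rule extensionality) (use c(2) in \<open>simp add: x y\<close>)
    then show ?thesis using c(1) by simp
  qed
  show ?thesis by (rule extensionality) (use sub[OF P eq] sub[OF P(2,1) eq[symmetric]] in blast)
qed

lemma eqpoll_Pow_FinFin_Pow_Bfin:
  assumes A: "\<not> fin A"
  shows "Pow_in E (Fin_in E (Fin_in E A)) \<approx> Pow_in E (Bfin_in E A)"
proof (rule schroeder_bernstein[OF dterm_odd_code dterm_nontrivial_parts])
  fix X assume "X \<epsilon> Pow_in E (Fin_in E (Fin_in E A))"
  show "odd_code A X \<epsilon> Pow_in E (Bfin_in E A)"
    unfolding mem_Pow sub_in_def mem_odd_code by blast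
next
  fix X assume X: "X \<epsilon> Pow_in E (Bfin_in E A)"
  have "nonsingletons_in E P \<epsilon> Fin_in E (Fin_in E A)" if "P \<epsilon> Bfin_in E A" for P
    using that unfolding mem_Bfin mem_Fin sub_in_def[of E "nonsingletons_in E P"]
      mem_nonsingletons partition_in_def by blast
  then show "nontrivial_parts X \<epsilon> Pow_in E (Fin_in E (Fin_in E A))"
    using X unfolding mem_Pow sub_in_def[of E X] sub_in_def[of E "nontrivial_parts X"] mem_nontrivial_parts by blast
next
  fix X X' assume "X \<epsilon> Pow_in E (Fin_in E (Fin_in E A))" "X' \<epsilon> Pow_in E (Fin_in E (Fin_in E A))"
    "odd_code A X = odd_code A X'"
  then show "X = X'" using odd_code_inj[OF A] unfolding mem_Pow by blast
next
  fix X X' assume X: "X \<epsilon> Pow_in E (Bfin_in E A)" "X' \<epsilon> Pow_in E (Bfin_in E A)" and eq: "nontrivial_parts X = nontrivial_parts X'"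
  have part: "partition_in E A P" if "P \<epsilon> X \<or> P \<epsilon> X'" for P
    using that X unfolding mem_Pow sub_in_def[of E X] sub_in_def[of E X'] mem_Bfin by blast
  have sub: "P \<epsilon> Z'" if Z: "nontrivial_parts Z = nontrivial_parts Z'" "\<And>P. P \<epsilon> Z \<or> P \<epsilon> Z' \<Longrightarrow> partition_in E A P" "P \<epsilon> Z" for Z Z' P
  proof -
    have "nonsingletons_in E P \<epsilon> nontrivial_parts Z" using Z(3) unfolding mem_nontrivial_parts by blast
    then obtain P' where P': "P' \<epsilon> Z'" "nonsingletons_in E P = nonsingletons_in E P'"
      unfolding Z(1) mem_nontrivial_parts by blast
    then have "P = P'" using nonsingletons_inj Z(2,3) by blast
    then show ?thesis using P'(1) by simp
  qed
  show "X = X'"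
  proof (rule extensionality, intro allI iffI)
    show "P \<epsilon> X'" if "P \<epsilon> X" for P by (rule sub[OF eq part that])
    show "P \<epsilon> X" if "P \<epsilon> X'" for P by (rule sub[OF eq[symmetric] _ that]) (use part in blast)
  qed
qed

end

theorem corollary3p8:
  fixes E :: "'v \<Rightarrow> 'v \<Rightarrow> bool"
  assumes "ZF_model E"
  shows "\<forall>A. \<not> finite_in E A \<longrightarrow>
           eqpoll_in E (Pow_in E (Fin_in E (Fin_in E A))) (Pow_in E (Bfin_in E A))"
  using ZF_model.eqpoll_Pow_FinFin_Pow_Bfin[OF assms] by blast

end
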